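(* In $\widetilde{\mathcal U}[[u,v]]$ one has $$\exp(x_0^+u)\exp(x_1^-v)=\exp(\alpha_-(w^2).x_1^-)\,\exp(\beta_-(w).X_1^-)\,\exp(\gamma_-(w^2).x_0^-)\,\exp(\eta(w).h_0)\,\exp(\gamma_+(w^2).x_1^+)\,\exp(\beta_+(w).X_1^+)\,\exp(\alpha_+(w^2).x_0^+)$$ where $$\alpha_+(w)=\frac{(1+wu^2v^2)u}{1-6wu^2v^2+w^2u^4v^4},\qquad \alpha_-(w)=\frac{(1+wu^2v^2)v}{1-6wu^2v^2+w^2u^4v^4},$$ $$\beta_+(w)=\frac{(1-4wu^2v^2-w^2u^4v^4)u^3v}{(1+6wu^2v^2+w^2u^4v^4)^2},\qquad \beta_-(w)=\frac{(1-4wu^2v^2-w^2u^4v^4)wuv^3}{(1+6wu^2v^2+w^2u^4v^4)^2},$$ $$\gamma_+(w)=\frac{(-3+wu^2v^2)u^2v}{1-6wu^2v^2+w^2u^4v^4},\qquad \gamma_-(w)=\frac{(-3+wu^2v^2)wuv^2}{1-6wu^2v^2+w^2u^4v^4},$$ $$\eta(w)=\tfrac12\ln(1+2wuv-w^2u^2v^2).$$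
   Context: The Lie algebra $\mathfrak g$ of type $A_2^{(2)}$ (and its enveloping algebra $\widetilde{\mathcal U}$, as associative algebra) is generated over $\mathbb Q$ by $\{c,h_r,x_r^\pm,X_{2r+1}^\pm\mid r\in\mathbb Z\}$ (which is a basis of $\mathfrak g$) with relations: $c$ central; $[h_r,h_s]=\delta_{r+s,0}\,2r(2+(-1)^{r-1})c$; $[h_r,x_s^\pm]=\pm2(2+(-1)^{r-1})x_{r+s}^\pm$; for $s$ odd, $[h_r,X_s^\pm]=\pm4X_{r+s}^\pm$ if $r$ is even and $0$ if $r$ is odd; $[x_r^\pm,x_s^\pm]=0$ if $r+s$ is even and $\pm(-1)^sX_{r+s}^\pm$ if $r+s$ is odd; $[x_r^\pm,X_s^\pm]=[X_r^\pm,X_s^\pm]=0$; $[x_r^+,x_s^-]=h_{r+s}+\delta_{r+s,0}\,rc$; $[x_r^\pm,X_s^\mp]=\pm(-1)^r4x_{r+s}^\mp$ ($s$ odd); $[X_r^+,X_s^-]=8h_{r+s}+4\delta_{r+s,0}\,rc$ ($r,s$ odd). Let $L\subset\mathfrak g$ be the $\mathbb Q$-span of $x_r^\pm$, $X_{2r+1}^\pm$, $h_r$ with $r\ge0$. It is a $\mathbb Q[w]$-module via $w.x_r^\pm=x_{r+1}^\pm$, $w.X_{2r+1}^\pm=-X_{2r+3}^\pm$, $w.h_r=h_{r+1}$; thus $w^r.x_0^\pm=x_r^\pm$, $w^r.x_1^\pm=x_{r+1}^\pm$, $w^r.X_1^\pm=(-1)^rX_{2r+1}^\pm$, $w^r.h_0=h_r$.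 For $\xi(w)\in\mathbb Q[w][[u,v]]$ and $y\in L$, $\xi(w).y\in L[[u,v]]$ is defined coefficientwise. The rational functions and logarithm are expanded as power series in $u,v$ with coefficients in $\mathbb Q[w]$. *)

theory Defs
  imports "HOL-Computational_Algebra.Computational_Algebra" "HOL-Library.Poly_Mapping"
begin

section \<open>The enveloping algebra by generators and relations\<close>

datatype pm = Plus | Minus

fun opp :: "pm \<Rightarrow> pm" where
  "opp Plus = Minus"
| "opp Minus = Plus"

fun pm_val :: "pm \<Rightarrow> rat" where
  "pm_val Plus = 1"
| "pm_val Minus = -1"

text \<open>
  Only odd indices occur in \<open>X\<^sub>s\<^sup>\<plusminus>\<close>: the constructor \<open>GX \<sigma> k\<close> stands for \<open>X\<^sub>2\<^sub>k\<^sub>+\<^sub>1\<^sup>\<plusminus>\<close>.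
\<close>
datatype gen = GC | GH int | Gx pm int | GX pm int

text \<open>
  Words in the generators form the free monoid, written additively so that the free associative
  algebra over the rationals is its monoid algebra (finitely supported functions with
  convolution product).
\<close>
datatype word = Word "gen list"

instantiation word :: monoid_add
begin
definition zero_word :: word where "0 = Word []"
fun plus_word :: "word \<Rightarrow> word \<Rightarrow> word" where "Word a + Word b = Word (a @ b)"
instance
proof
  fix a b c :: word
  show "a + b + c = a + (b + c)" by (cases a; cases b; cases c) simp
  show "0 + a = a" "a + 0 = a" by (cases a; simp add: zero_word_def)+
qed
end

type_synonym free_alg = "word \<Rightarrow>\<^sub>0 rat"

definition free_const :: "rat \<Rightarrow> free_alg" where
  "free_const q = Poly_Mapping.single 0 q"

definition free_gen :: "gen \<Rightarrow> free_alg" where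
  "free_gen g = Poly_Mapping.single (Word [g]) 1"

abbreviation fc :: free_alg where "fc \<equiv> free_gen GC"
abbreviation fh :: "int \<Rightarrow> free_alg" where "fh r \<equiv> free_gen (GH r)"
abbreviation fx :: "pm \<Rightarrow> int \<Rightarrow> free_alg" where "fx \<sigma> r \<equiv> free_gen (Gx \<sigma> r)"

text \<open>\<open>fX \<sigma> s\<close> is \<open>X\<^sub>s\<^sup>\<plusminus>\<close>, to be used for odd \<open>s\<close> only.\<close>
abbreviation fX :: "pm \<Rightarrow> int \<Rightarrow> free_alg" where "fX \<sigma> s \<equiv> free_gen (GX \<sigma> (s div 2))"

abbreviation comm :: "'a::ring \<Rightarrow> 'a \<Rightarrow> 'a" where "comm a b \<equiv> a * b - b * a"

inductive A22_rel :: "free_alg \<Rightarrow> free_alg \<Rightarrow> bool" where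
  c_central: "A22_rel (comm fc (free_gen g)) 0"
| h_h: "A22_rel (comm (fh r) (fh s))
    (if r + s = 0 then free_const (2 * of_int r * (2 + (-1) powi (r - 1))) * fc else 0)"
| h_x: "A22_rel (comm (fh r) (fx \<sigma> s))
    (free_const (pm_val \<sigma> * 2 * (2 + (-1) powi (r - 1))) * fx \<sigma> (r + s))"
| h_X: "odd s \<Longrightarrow> A22_rel (comm (fh r) (fX \<sigma> s))
    (if even r then free_const (pm_val \<sigma> * 4) * fX \<sigma> (r + s) else 0)"
| x_x_same: "A22_rel (comm (fx \<sigma> r) (fx \<sigma> s))
    (if even (r + s) then 0 else free_const (pm_val \<sigma> * (-1) powi s) * fX \<sigma> (r + s))"
| x_X_same: "odd s \<Longrightarrow> A22_rel (comm (fx \<sigma> r) (fX \<sigma> s)) 0"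
| X_X_same: "odd r \<Longrightarrow> odd s \<Longrightarrow> A22_rel (comm (fX \<sigma> r) (fX \<sigma> s)) 0"
| x_x_opp: "A22_rel (comm (fx Plus r) (fx Minus s))
    (fh (r + s) + (if r + s = 0 then free_const (of_int r) * fc else 0))"
| x_X_opp: "odd s \<Longrightarrow> A22_rel (comm (fx \<sigma> r) (fX (opp \<sigma>) s))
    (free_const (pm_val \<sigma> * (-1) powi r * 4) * fx (opp \<sigma>) (r + s))"
| X_X_opp: "odd r \<Longrightarrow> odd s \<Longrightarrow> A22_rel (comm (fX Plus r) (fX Minus s))
    (free_const 8 * fh (r + s) + (if r + s = 0 then free_const (4 * of_int r) * fc else 0))"

inductive_set A22_ideal :: "free_alg set" where
  zero: "0 \<in> A22_ideal"
| rel: "A22_rel a b \<Longrightarrow> a - b \<in> A22_ideal"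
| add: "a \<in> A22_ideal \<Longrightarrow> b \<in> A22_ideal \<Longrightarrow> a + b \<in> A22_ideal"
| mult: "a \<in> A22_ideal \<Longrightarrow> p * a * q \<in> A22_ideal"

definition A22_eq :: "free_alg \<Rightarrow> free_alg \<Rightarrow> bool" where
  "A22_eq a b \<longleftrightarrow> a - b \<in> A22_ideal"

lemma A22_ideal_uminus: "a \<in> A22_ideal \<Longrightarrow> - a \<in> A22_ideal"
  using A22_ideal.mult[of a "-1" 1] by simp

lemma A22_ideal_lmult: "a \<in> A22_ideal \<Longrightarrow> p * a \<in> A22_ideal"
  using A22_ideal.mult[of a p 1] by simp

lemma A22_ideal_rmult: "a \<in> A22_ideal \<Longrightarrow> a * q \<in> A22_ideal"
  using A22_ideal.mult[of a 1 q] by simp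

lemma word_add_eq_0: "(0::word) = k + l \<longleftrightarrow> k = 0 \<and> l = 0"
  by (cases k; cases l) (auto simp: zero_word_def)

lemma lookup_times_0:
  "Poly_Mapping.lookup (a * b) (0::word) = Poly_Mapping.lookup a 0 * Poly_Mapping.lookup (b :: free_alg) 0"
proof -
  have "Poly_Mapping.lookup (a * b) 0 = (\<Sum>l. Poly_Mapping.lookup a l * (\<Sum>q. Poly_Mapping.lookup b q when 0 = l + q))"
    by (rule lookup_mult)
  also have "(\<lambda>l. Poly_Mapping.lookup a l * (\<Sum>q. Poly_Mapping.lookup b q when 0 = l + q)) =
      (\<lambda>l. Poly_Mapping.lookup a l * Poly_Mapping.lookup b 0 when l = 0)"
  proof
    fix l :: word
    show "Poly_Mapping.lookup a l * (\<Sum>q. Poly_Mapping.lookup b q when 0 = l + q) = (Poly_Mapping.lookup a l * Poly_Mapping.lookup b 0 when l = 0)"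
      by (cases "l = 0") (simp_all add: word_add_eq_0 when_def)
  qed
  finally show ?thesis by simp
qed

lemma lookup_free_gen_0: "Poly_Mapping.lookup (free_gen g) 0 = 0"
  by (simp add: free_gen_def zero_word_def lookup_single when_def)

lemma A22_rel_lookup_0: "A22_rel a b \<Longrightarrow> Poly_Mapping.lookup a 0 = 0 \<and> Poly_Mapping.lookup b 0 = 0"
  by (induction rule: A22_rel.induct)
    (simp_all add: lookup_minus lookup_add lookup_times_0 lookup_free_gen_0)

lemma A22_ideal_lookup_0: "a \<in> A22_ideal \<Longrightarrow> Poly_Mapping.lookup a 0 = 0"
  by (induction rule: A22_ideal.induct)
    (simp_all add: lookup_minus lookup_add lookup_times_0 A22_rel_lookup_0)

lemma equivp_A22_eq: "equivp A22_eq"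
proof (rule equivpI)
  show "reflp A22_eq" by (simp add: reflp_def A22_eq_def A22_ideal.zero)
  show "symp A22_eq"
    unfolding symp_def A22_eq_def by (metis A22_ideal_uminus minus_diff_eq)
  show "transp A22_eq"
    unfolding transp_def A22_eq_def
    by (metis A22_ideal.add add_diff_eq diff_add_cancel)
qed

quotient_type env = free_alg / A22_eq
  by (rule equivp_A22_eq)

instantiation env :: ring_1
begin

lift_definition zero_env :: env is 0 .
lift_definition one_env :: env is 1 .

lift_definition plus_env :: "env \<Rightarrow> env \<Rightarrow> env" is "(+)"
  unfolding A22_eq_def by (metis A22_ideal.add add_diff_add)

lift_definition uminus_env :: "env \<Rightarrow> env" is uminus
  unfolding A22_eq_def by (metis A22_ideal_uminus minus_diff_minus)

lift_definition minus_env :: "env \<Rightarrow> env \<Rightarrow> env" is "(-)"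
  unfolding A22_eq_def
  by (metis (no_types, opaque_lifting) A22_ideal.add A22_ideal_uminus add_diff_add
      minus_diff_minus diff_conv_add_uminus)

lift_definition times_env :: "env \<Rightarrow> env \<Rightarrow> env" is "(*)"
proof -
  fix a b p q
  assume "A22_eq a b" "A22_eq p q"
  then have "(a - b) * p + b * (p - q) \<in> A22_ideal"
    unfolding A22_eq_def by (intro A22_ideal.add A22_ideal_lmult A22_ideal_rmult)
  then show "A22_eq (a * p) (b * q)"
    by (simp add: A22_eq_def algebra_simps)
qed

instance
proof
  fix a b c :: env
  show "a + b + c = a + (b + c)" by transfer (simp add: A22_eq_def A22_ideal.zero algebra_simps)
  show "a + b = b + a" by transfer (simp add: A22_eq_def A22_ideal.zero algebra_simps)
  show "0 + a = a" by transfer (simp add: A22_eq_def A22_ideal.zero)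
  show "- a + a = 0" by transfer (simp add: A22_eq_def A22_ideal.zero)
  show "a - b = a + - b" by transfer (simp add: A22_eq_def A22_ideal.zero)
  show "a * b * c = a * (b * c)" by transfer (simp add: A22_eq_def A22_ideal.zero mult.assoc)
  show "1 * a = a" "a * 1 = a" by (transfer, simp add: A22_eq_def A22_ideal.zero)+
  show "(a + b) * c = a * c + b * c"
    by transfer (simp add: A22_eq_def A22_ideal.zero algebra_simps)
  show "a * (b + c) = a * b + a * c"
    by transfer (simp add: A22_eq_def A22_ideal.zero algebra_simps)
  show "(0::env) \<noteq> 1"
  proof transfer
    have "Poly_Mapping.lookup (0 - 1 :: free_alg) 0 \<noteq> 0" by (simp add: lookup_minus lookup_one)
    then show "\<not> A22_eq 0 1" unfolding A22_eq_def using A22_ideal_lookup_0 by blast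
  qed
qed

end

lift_definition env_const :: "rat \<Rightarrow> env" is free_const .
lift_definition env_gen :: "gen \<Rightarrow> env" is free_gen .


section \<open>The module \<open>L\<close> over \<open>\<rat>[w]\<close>\<close>

text \<open>
  The elements \<open>x\<^sub>r\<^sup>\<plusminus>\<close>, \<open>X\<^sub>2\<^sub>r\<^sub>+\<^sub>1\<^sup>\<plusminus>\<close>, \<open>h\<^sub>r\<close> with \<open>r \<ge> 0\<close> are part of a basis of the Lie algebra, so
  their span \<open>L\<close> is the free vector space on them. As before, \<open>LX \<sigma> r\<close> stands for
  \<open>X\<^sub>2\<^sub>r\<^sub>+\<^sub>1\<^sup>\<plusminus>\<close>.
\<close>
datatype lgen = Lh nat | Lx pm nat | LX pm nat

type_synonym L = "lgen \<Rightarrow>\<^sub>0 rat"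

abbreviation L_gen :: "lgen \<Rightarrow> L" where "L_gen b \<equiv> Poly_Mapping.single b 1"

definition L_scale :: "rat \<Rightarrow> L \<Rightarrow> L" where
  "L_scale q = Poly_Mapping.map ((*) q)"

fun w_gen :: "lgen \<Rightarrow> L" where
  "w_gen (Lh r) = L_gen (Lh (Suc r))"
| "w_gen (Lx \<sigma> r) = L_gen (Lx \<sigma> (Suc r))"
| "w_gen (LX \<sigma> r) = - L_gen (LX \<sigma> (Suc r))"

definition w_act :: "L \<Rightarrow> L" where
  "w_act y = (\<Sum>b\<in>Poly_Mapping.keys y. L_scale (Poly_Mapping.lookup y b) (w_gen b))"

definition poly_act :: "rat poly \<Rightarrow> L \<Rightarrow> L" where
  "poly_act p y = (\<Sum>n\<le>Polynomial.degree p. L_scale (poly.coeff p n) ((w_act ^^ n) y))"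

fun incl_gen :: "lgen \<Rightarrow> gen" where
  "incl_gen (Lh r) = GH (int r)"
| "incl_gen (Lx \<sigma> r) = Gx \<sigma> (int r)"
| "incl_gen (LX \<sigma> r) = GX \<sigma> (int r)"

definition L_to_env :: "L \<Rightarrow> env" where
  "L_to_env y = (\<Sum>b\<in>Poly_Mapping.keys y. env_const (Poly_Mapping.lookup y b) * env_gen (incl_gen b))"


section \<open>Power series in \<open>u\<close> and \<open>v\<close>\<close>

text \<open>
  \<open>A[[u,v]]\<close> is rendered as \<open>A[[v]][[u]]\<close>, i.e. as type \<open>'a fps fps\<close>: the coefficient of
  \<open>u\<^sup>i v\<^sup>j\<close> in \<open>z\<close> is \<open>coeff2 z i j\<close>. The product of formal power series does not assume the
  coefficients to commute with each other, but the variables are central.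
\<close>
abbreviation coeff2 :: "'a fps fps \<Rightarrow> nat \<Rightarrow> nat \<Rightarrow> 'a" where
  "coeff2 z i j \<equiv> fps_nth (fps_nth z i) j"

abbreviation const2 :: "'a::zero \<Rightarrow> 'a fps fps" where
  "const2 a \<equiv> fps_const (fps_const a)"

definition u :: "'a::ring_1 fps fps" where "u = fps_X"
definition v :: "'a::ring_1 fps fps" where "v = fps_const fps_X"

text \<open>
  The substitution of a series \<open>z\<close> with zero constant coefficient into a series \<open>f\<close> in one
  variable over the rationals, where \<open>\<iota>\<close> is the structure map of the coefficient algebra. Only
  the powers \<open>z\<^sup>n\<close> with \<open>n \<le> i + j\<close> contribute to the coefficient of \<open>u\<^sup>i v\<^sup>j\<close>.
\<close>
definition subst2 :: "(rat \<Rightarrow> 'a::ring_1) \<Rightarrow> rat fps \<Rightarrow> 'a fps fps \<Rightarrow> 'a fps fps" where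
  "subst2 \<iota> f z =
     Abs_fps (\<lambda>i. Abs_fps (\<lambda>j. \<Sum>n\<le>i + j. \<iota> (fps_nth f n) * coeff2 (z ^ n) i j))"

definition exp_env :: "env fps fps \<Rightarrow> env fps fps" where
  "exp_env z = subst2 env_const (fps_exp 1) z"

text \<open>\<open>fps_ln 1\<close> is the series of \<open>ln (1 + X)\<close>.\<close>
definition ln1p :: "rat poly fps fps \<Rightarrow> rat poly fps fps" where
  "ln1p z = subst2 (\<lambda>q. [:q:]) (fps_ln 1) z"

text \<open>
  Reciprocal of a series whose coefficient of \<open>u\<^sup>0\<close> is \<open>1\<close>; the library's \<open>inverse\<close> on power
  series requires an inverse on the coefficients.
\<close>
definition recip :: "rat poly fps fps \<Rightarrow> rat poly fps fps" where
  "recip d = fps_right_inverse d 1"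

lemma recip: "fps_nth d 0 = 1 \<Longrightarrow> d * recip d = 1"
  unfolding recip_def by (rule fps_right_inverse) simp

definition w :: "rat poly fps fps" where "w = const2 [:0, 1:]"

text \<open>\<open>\<xi>(w).y\<close>, with \<open>\<rat>[w]\<close> acting coefficientwise, regarded as a series over the enveloping algebra.\<close>
definition act :: "rat poly fps fps \<Rightarrow> L \<Rightarrow> env fps fps" (infixr "\<star>" 75) where
  "\<xi> \<star> y = Abs_fps (\<lambda>i. Abs_fps (\<lambda>j. L_to_env (poly_act (coeff2 \<xi> i j) y)))"


section \<open>The series in the exponents\<close>

text \<open>They are functions of their argument \<open>t\<close>, which will be \<open>w\<close> or \<open>w\<^sup>2\<close>.\<close>

definition alpha :: "pm \<Rightarrow> rat poly fps fps \<Rightarrow> rat poly fps fps" where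
  "alpha \<sigma> t = (1 + t * u^2 * v^2) * (case \<sigma> of Plus \<Rightarrow> u | Minus \<Rightarrow> v)
     * recip (1 - 6 * t * u^2 * v^2 + t^2 * u^4 * v^4)"

definition beta :: "pm \<Rightarrow> rat poly fps fps \<Rightarrow> rat poly fps fps" where
  "beta \<sigma> t = (1 - 4 * t * u^2 * v^2 - t^2 * u^4 * v^4)
     * (case \<sigma> of Plus \<Rightarrow> u^3 * v | Minus \<Rightarrow> t * u * v^3)
     * recip ((1 + 6 * t * u^2 * v^2 + t^2 * u^4 * v^4)^2)"

definition gamma :: "pm \<Rightarrow> rat poly fps fps \<Rightarrow> rat poly fps fps" where
  "gamma \<sigma> t = (- 3 + t * u^2 * v^2) * (case \<sigma> of Plus \<Rightarrow> u^2 * v | Minus \<Rightarrow> t * u * v^2)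
     * recip (1 - 6 * t * u^2 * v^2 + t^2 * u^4 * v^4)"

definition eta :: "rat poly fps fps \<Rightarrow> rat poly fps fps" where
  "eta t = const2 [:1/2:] * ln1p (2 * t * u * v - t^2 * u^2 * v^2)"

lemma denominators:
  "fps_nth (1 - 6 * t * u^2 * v^2 + t^2 * u^4 * v^4 :: rat poly fps fps) 0 = 1"
  "fps_nth ((1 + 6 * t * u^2 * v^2 + t^2 * u^4 * v^4)^2 :: rat poly fps fps) 0 = 1"
  by (simp_all add: u_def power2_eq_square fps_mult_nth_0 fps_nth_power_0)

end

theory Submission
  imports Defs
begin

text \<open>
  Both sides satisfy the differential equation \<open>\<partial>F/\<partial>u = x\<^sub>0\<^sup>+ F\<close> and agree at \<open>u = 0\<close>, so they coincide.
  Write the right-hand side as \<open>N H P\<close> with a negative, a Cartan and a positive part. Moving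
  \<open>x\<^sub>0\<^sup>+\<close> to the right through the three exponentials of \<open>N\<close> produces finitely many iterated
  brackets, and gives \<open>x\<^sub>0\<^sup>+ N = N' + N (x\<^sub>0\<^sup>+ + \<eta>'.h\<^sub>0)\<close>; furthermore \<open>x\<^sub>0\<^sup>+ H = H (\<mu>.x\<^sub>0\<^sup>+)\<close>, by
  uniqueness for another differential equation, and \<open>P' = (\<mu>.x\<^sub>0\<^sup>+) P\<close>, for one rational function
  \<open>\<mu>\<close>. All this amounts to differential identities between the rational functions in the exponents.
  The brackets become uniform when a series \<open>\<xi>(w)\<close> is used to index \<open>\<Sum> \<xi>\<^sub>r x\<^sub>r\<close>, \<open>\<Sum> \<xi>\<^sub>r h\<^sub>r\<close> and
  \<open>\<Sum> \<xi>\<^sub>r X\<^sub>r\<close> (over odd \<open>r\<close>): they are then expressed by the product of series and \<open>w \<mapsto> - w\<close>.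
\<close>

section \<open>Brackets in the enveloping algebra\<close>

lemma env_relI: "A22_rel a b \<Longrightarrow> abs_env a = abs_env b"
  by (simp add: env.abs_eq_iff A22_eq_def A22_ideal.rel)

text \<open>A scalar is carried by the empty word, which is neutral for concatenation on both
  sides.\<close>

lemma free_const_central: "free_const q * a = a * free_const q"
proof (induction a rule: update_induct)
  case const
  then show ?case by simp
next
  case (update f k c)
  have "Poly_Mapping.update k c f = Poly_Mapping.single k c + f"
    by (rule poly_mapping_eqI) (use update in \<open>auto simp: lookup_update lookup_add lookup_single in_keys_iff when_def\<close>)
  with update show ?case
    by (simp add: distrib_left distrib_right free_const_def mult_single mult.commute)
qed

lemma free_const_simps:
  "free_const (a + b) = free_const a + free_const b"
  "free_const (a * b) = free_const a * free_const b"
  "free_const 0 = 0" "free_const 1 = 1"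
  by (simp_all add: free_const_def single_add mult_single)

lemma env_const_central: "env_const q * a = a * env_const q"
  by transfer (simp add: free_const_central A22_eq_def A22_ideal.zero)

lemma env_const_simps:
  "env_const (a + b) = env_const a + env_const b"
  "env_const (a * b) = env_const a * env_const b"
  "env_const 0 = 0" "env_const 1 = 1"
  by (transfer, simp add: free_const_simps A22_eq_def A22_ideal.zero)+

interpretation env_const: additive env_const
  by standard (rule env_const_simps)

lemma env_const_of_nat: "env_const (of_nat n) = of_nat n"
  by (induction n) (simp_all add: env_const_simps)

lemma env_const_left_commute: "a * (env_const q * b) = env_const q * (a * b)"
  by (simp flip: mult.assoc env_const_central)

lemma env_const_scale: "(env_const a * x) * (env_const b * y) = env_const (a * b) * (x * y)"
  unfolding env_const_simps mult.assoc by (subst env_const_left_commute[of x b y]) (rule refl)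

lemma comm_scale:
  "comm (env_const a * x) (env_const b * y) = env_const (a * b) * comm x y"
  by (simp add: env_const_scale right_diff_distrib) (simp add: env_const_scale mult.commute[of a])

text \<open>\<open>gX \<sigma> n\<close> is \<open>X\<^sub>n\<^sup>\<plusminus>\<close> for odd \<open>n\<close>, unlike \<open>GX\<close>, whose index is \<open>n div 2\<close>; the value
  \<open>0\<close> at even \<open>n\<close> makes all brackets uniform in the indices.\<close>

definition gh :: "nat \<Rightarrow> env" where "gh n = env_gen (GH (int n))"
definition gx :: "pm \<Rightarrow> nat \<Rightarrow> env" where "gx \<sigma> n = env_gen (Gx \<sigma> (int n))"
definition gX :: "pm \<Rightarrow> nat \<Rightarrow> env" where
  "gX \<sigma> n = (if even n then 0 else env_gen (GX \<sigma> (int n div 2)))"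

lemma abs_env_simps:
  "abs_env (a * b) = abs_env a * abs_env b" "abs_env (a - b) = abs_env a - abs_env b"
  "abs_env (a + b) = abs_env a + abs_env b" "abs_env 0 = 0"
  "abs_env (free_const q) = env_const q" "abs_env (free_gen g) = env_gen g"
  by (simp_all add: times_env.abs_eq minus_env.abs_eq plus_env.abs_eq zero_env.abs_eq
      env_const.abs_eq env_gen.abs_eq)

lemma powi_pred: "(-1 :: rat) powi (int m - 1) = - ((-1) ^ m)"
  by (simp add: power_int_diff)

text \<open>For nonnegative indices the central term can occur only at \<open>m = n = 0\<close>,
  where its coefficient vanishes. The same happens in \<open>comm_gx_gx_opp\<close>.\<close>

lemma comm_gh_gh: "comm (gh m) (gh n) = 0"
  using env_relI[OF h_h[of "int m" "int n"]]
  by (cases "m = 0"; cases "n = 0") (simp_all add: abs_env_simps gh_def env_const_simps)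

lemma comm_gh_gx: "comm (gh m) (gx \<sigma> n) = env_const (pm_val \<sigma> * (4 - 2 * (-1) ^ m)) * gx \<sigma> (m + n)"
  using env_relI[OF h_x[of "int m" \<sigma> "int n"]]
  by (simp add: abs_env_simps gh_def gx_def powi_pred algebra_simps)

text \<open>The factor \<open>2 + 2 * (-1) ^ m\<close> encodes the case distinction on the parity of
  \<open>m\<close>. For even \<open>n\<close> both sides vanish: either this factor is 0 or
  \<open>m + n\<close> is even.\<close>

lemma comm_gh_gX: "comm (gh m) (gX \<sigma> n) = env_const (pm_val \<sigma> * (2 + 2 * (-1) ^ m)) * gX \<sigma> (m + n)"
proof (cases "even n")
  case True
  then show ?thesis by (auto simp: gX_def env_const_simps(3))
next
  case False
  with env_relI[OF h_X[of "int n" "int m" \<sigma>]] show ?thesis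
    by (cases "even m") (simp_all add: abs_env_simps gh_def gX_def env_const_simps(3) mult.commute)
qed

lemma comm_gx_gx: "comm (gx \<sigma> m) (gx \<sigma> n) = env_const (pm_val \<sigma> * (-1) ^ n) * gX \<sigma> (m + n)"
  using env_relI[OF x_x_same[of \<sigma> "int m" "int n"]]
  by (auto simp: abs_env_simps gx_def gX_def)

lemma comm_gx_gX: "comm (gx \<sigma> m) (gX \<sigma> n) = 0"
  using env_relI[OF x_X_same[of "int n" \<sigma> "int m"]]
  by (auto simp: abs_env_simps gx_def gX_def)

lemma comm_gX_gX: "comm (gX \<sigma> m) (gX \<sigma> n) = 0"
  using env_relI[OF X_X_same[of "int m" "int n" \<sigma>]]
  by (auto simp: abs_env_simps gX_def)

lemma comm_gx_gx_opp: "comm (gx Plus m) (gx Minus n) = env_const 1 * gh (m + n)"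
  using env_relI[OF x_x_opp[of "int m" "int n"]]
  by (cases "m = 0"; cases "n = 0") (simp_all add: abs_env_simps gx_def gh_def env_const_simps(3,4))

text \<open>The factor \<open>1 - (-1) ^ n\<close> is 2 at odd \<open>n\<close>. It is 0 at even
  \<open>n\<close>, where the left side vanishes but \<open>gx Minus (m + n)\<close> need
  not.\<close>

lemma comm_gx_gX_opp: "comm (gx Plus m) (gX Minus n) =
   env_const (2 * (-1) ^ m * (1 - (-1) ^ n)) * gx Minus (m + n)"
proof (cases "even n")
  case True
  then show ?thesis by (auto simp: gX_def env_const_simps)
next
  case False
  with env_relI[OF x_X_opp[of "int n" Plus "int m"]] show ?thesis
    by (simp add: abs_env_simps gx_def gX_def mult.commute)
qed


section \<open>Polynomial multiples of the generators\<close>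

lemma additive_poly_eqI:
  fixes f g :: "'a::ab_group_add poly \<Rightarrow> 'b::ab_group_add"
  assumes "additive f" "additive g" and "\<And>c n. f (Polynomial.monom c n) = g (Polynomial.monom c n)"
  shows "f p = g p"
proof -
  have "f (\<Sum>i\<le>n. Polynomial.monom (poly.coeff p i) i) = g (\<Sum>i\<le>n. Polynomial.monom (poly.coeff p i) i)" for n
    by (induction n) (simp_all add: assms(3) additive.add[OF assms(1)] additive.add[OF assms(2)])
  from this[of "Polynomial.degree p"] show ?thesis by (simp add: poly_as_sum_of_monoms)
qed

text \<open>The linear map that sends \<open>w ^ n\<close> to \<open>g n\<close>: a polynomial
  serves as a label for an element of the enveloping algebra.\<close>

definition lin :: "(nat \<Rightarrow> env) \<Rightarrow> rat poly \<Rightarrow> env" where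
  "lin g p = (\<Sum>n\<le>Polynomial.degree p. env_const (poly.coeff p n) * g n)"

lemma lin_bound:
  "Polynomial.degree p \<le> N \<Longrightarrow> lin g p = (\<Sum>n\<le>N. env_const (poly.coeff p n) * g n)"
  unfolding lin_def by (rule sum.mono_neutral_left) (auto simp: coeff_eq_0 env_const_simps)

lemma additive_lin: "additive (lin g)"
proof
  fix p q :: "rat poly"
  let ?N = "max (Polynomial.degree p) (Polynomial.degree q)"
  show "lin g (p + q) = lin g p + lin g q"
    using lin_bound[of p ?N g] lin_bound[of q ?N g] lin_bound[of "p + q" ?N g]
    by (simp add: degree_add_le_max env_const_simps distrib_right sum.distrib)
qed

lemma lin_monom [simp]: "lin g (Polynomial.monom c n) = env_const c * g n"
proof -
  have "lin g (Polynomial.monom c n) = (\<Sum>k\<le>n. env_const (poly.coeff (Polynomial.monom c n) k) * g k)"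
    by (rule lin_bound) (rule degree_monom_le)
  also have "\<dots> = (\<Sum>k\<le>n. if k = n then env_const c * g n else 0)"
    by (rule sum.cong) (auto simp: env_const_simps)
  finally show ?thesis by simp
qed

text \<open>The signs \<open>(-1) ^ n\<close> in the structure constants become this substitution on
  labels.\<close>

definition sgn_flip :: "rat poly \<Rightarrow> rat poly" where "sgn_flip p = pcompose p [:0, -1:]"

lemma sgn_flip_simps:
  "sgn_flip (p + q) = sgn_flip p + sgn_flip q"
  "sgn_flip (p * q) = sgn_flip p * sgn_flip q" "sgn_flip 1 = 1"
  by (simp_all add: sgn_flip_def pcompose_add pcompose_mult pcompose_1)

lemma sgn_flip_monom [simp]: "sgn_flip (Polynomial.monom c n) = Polynomial.monom (c * (-1) ^ n) n"
proof (induction n)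
  case 0
  then show ?case by (simp add: sgn_flip_def monom_0)
next
  case (Suc n)
  then show ?case by (simp add: sgn_flip_def monom_Suc pcompose_pCons smult_monom)
qed

text \<open>Both sides are additive in \<open>p\<close> and in \<open>q\<close>, so monomials
  decide; there the structure constants \<open>c i j\<close> are absorbed by \<open>m\<close> and
  \<open>n\<close>.\<close>

lemma lin_bracket:
  assumes "\<And>i j. comm (g i) (k j) = env_const (c i j) * l (i + j)"
    and "additive m" "additive n"
    and "\<And>a b i j. m (Polynomial.monom a i) * n (Polynomial.monom b j) =
       Polynomial.monom (a * b * c i j) (i + j)"
  shows "comm (lin g p) (lin k q) = lin l (m p * n q)"
proof (rule additive_poly_eqI[where f = "\<lambda>p. comm (lin g p) (lin k q)" and g = "\<lambda>p. lin l (m p * n q)"])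
  interpret m: additive m by fact
  interpret n: additive n by fact
  interpret g: additive "lin g" by (rule additive_lin)
  interpret k: additive "lin k" by (rule additive_lin)
  interpret l: additive "lin l" by (rule additive_lin)
  show "additive (\<lambda>p. comm (lin g p) (lin k q))"
    by standard (simp add: g.add algebra_simps)
  show "additive (\<lambda>p. lin l (m p * n q))"
    by standard (simp add: m.add l.add distrib_right)
  fix a i
  show "comm (lin g (Polynomial.monom a i)) (lin k q) = lin l (m (Polynomial.monom a i) * n q)"
  proof (rule additive_poly_eqI[where f = "\<lambda>q. comm (lin g (Polynomial.monom a i)) (lin k q)"])
    show "additive (\<lambda>q. comm (lin g (Polynomial.monom a i)) (lin k q))"
      by standard (simp add: k.add algebra_simps)
    show "additive (\<lambda>q. lin l (m (Polynomial.monom a i) * n q))"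
      by standard (simp add: n.add l.add distrib_left)
  qed (simp only: assms(1,4) lin_monom comm_scale, simp add: env_const_simps(2) mult.assoc)
qed

lemma lin_commute:
  assumes "\<And>i j. comm (g i) (k j) = 0"
  shows "comm (lin g p) (lin k q) = 0"
proof -
  have "comm (lin g p) (lin k q) = lin (\<lambda>_. 0) (0 * q)"
    by (rule lin_bracket[where c = "\<lambda>_ _. 0"]) (simp_all add: assms additive_def)
  then show ?thesis by (simp add: lin_def)
qed

interpretation sgn_flip: additive sgn_flip
  by standard (rule sgn_flip_simps)

lemma numeral_monom:
  "numeral k * Polynomial.monom (a::rat) i = Polynomial.monom (numeral k * a) i"
  "Polynomial.monom (a::rat) i * numeral k = Polynomial.monom (a * numeral k) i"
  by (simp_all add: numeral_poly smult_monom mult.commute)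

lemma bracket_additive:
  "additive (\<lambda>p::rat poly. p)" "additive (\<lambda>p. sgn_flip p)"
  "additive (\<lambda>p. - sgn_flip p)"
  "additive (\<lambda>p. 4 * p - 2 * sgn_flip p)" "additive (\<lambda>p. 2 * sgn_flip p - 4 * p)"
  "additive (\<lambda>p. - 2 * (p + sgn_flip p))"
  "additive (\<lambda>p. 2 * sgn_flip p)" "additive (\<lambda>p. p - sgn_flip p)"
  by (standard; simp add: sgn_flip_simps algebra_simps)+

lemma commute_lin:
  "comm (lin gh p) (lin gh q) = 0"
  "comm (lin (gx \<sigma>) p) (lin (gX \<sigma>) q) = 0"
  "comm (lin (gX \<sigma>) p) (lin (gX \<sigma>) q) = 0"
  by (rule lin_commute, rule comm_gh_gh comm_gx_gX comm_gX_gX)+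

lemmas poly_monom_simps =
  mult_monom numeral_monom add_monom diff_monom minus_monom pm_val.simps algebra_simps

text \<open>Each structure constant is a polynomial in \<open>(-1) ^ i\<close> times one in
  \<open>(-1) ^ j\<close>, and each such sign is traded for \<open>sgn_flip\<close> on the
  corresponding argument.\<close>

lemma comm_lin:
  "comm (lin gh p) (lin (gx Plus) q) = lin (gx Plus) ((4 * p - 2 * sgn_flip p) * q)"
  "comm (lin gh p) (lin (gx Minus) q) = lin (gx Minus) ((2 * sgn_flip p - 4 * p) * q)"
  "comm (lin gh p) (lin (gX Minus) q) = lin (gX Minus) ((- 2 * (p + sgn_flip p)) * q)"
  "comm (lin (gx Plus) p) (lin (gx Plus) q) = lin (gX Plus) (p * sgn_flip q)"
  "comm (lin (gx Minus) p) (lin (gx Minus) q) = lin (gX Minus) (p * - sgn_flip q)"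
  "comm (lin (gx Plus) p) (lin (gx Minus) q) = lin gh (p * q)"
  "comm (lin (gx Plus) p) (lin (gX Minus) q) = lin (gx Minus) (2 * sgn_flip p * (q - sgn_flip q))"
proof -
  show "comm (lin gh p) (lin (gx Plus) q) = lin (gx Plus) ((4 * p - 2 * sgn_flip p) * q)"
    by (rule lin_bracket[where m = "\<lambda>p. 4 * p - 2 * sgn_flip p" and n = "\<lambda>p. p"])
      (rule comm_gh_gx bracket_additive | simp add: poly_monom_simps)+
  show "comm (lin gh p) (lin (gx Minus) q) = lin (gx Minus) ((2 * sgn_flip p - 4 * p) * q)"
    by (rule lin_bracket[where m = "\<lambda>p. 2 * sgn_flip p - 4 * p" and n = "\<lambda>p. p"])
      (rule comm_gh_gx bracket_additive | simp add: poly_monom_simps)+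
  show "comm (lin gh p) (lin (gX Minus) q) = lin (gX Minus) ((- 2 * (p + sgn_flip p)) * q)"
    by (rule lin_bracket[where m = "\<lambda>p. - 2 * (p + sgn_flip p)" and n = "\<lambda>p. p"])
      (rule comm_gh_gX bracket_additive | simp add: poly_monom_simps)+
  show "comm (lin (gx Plus) p) (lin (gx Plus) q) = lin (gX Plus) (p * sgn_flip q)"
    by (rule lin_bracket[where m = "\<lambda>p. p" and n = "sgn_flip"])
      (rule comm_gx_gx bracket_additive | simp add: poly_monom_simps)+
  show "comm (lin (gx Minus) p) (lin (gx Minus) q) = lin (gX Minus) (p * - sgn_flip q)"
    by (rule lin_bracket[where m = "\<lambda>p. p" and n = "\<lambda>p. - sgn_flip p"])
      (rule comm_gx_gx bracket_additive | simp add: poly_monom_simps)+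
  show "comm (lin (gx Plus) p) (lin (gx Minus) q) = lin gh (p * q)"
    by (rule lin_bracket[where m = "\<lambda>p. p" and n = "\<lambda>p. p"])
      (rule comm_gx_gx_opp bracket_additive | simp add: poly_monom_simps)+
  show "comm (lin (gx Plus) p) (lin (gX Minus) q) = lin (gx Minus) (2 * sgn_flip p * (q - sgn_flip q))"
    by (rule lin_bracket[where m = "\<lambda>p. 2 * sgn_flip p" and n = "\<lambda>p. p - sgn_flip p"])
      (rule comm_gx_gX_opp bracket_additive | simp add: poly_monom_simps)+
qed


section \<open>Coefficientwise maps\<close>

definition map_coeffs :: "('a \<Rightarrow> 'b) \<Rightarrow> 'a fps \<Rightarrow> 'b fps" where
  "map_coeffs f x = Abs_fps (\<lambda>i. f (fps_nth x i))"

abbreviation map2 :: "('a \<Rightarrow> 'b) \<Rightarrow> 'a fps fps \<Rightarrow> 'b fps fps" where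
  "map2 f \<equiv> map_coeffs (map_coeffs f)"

lemma map_coeffs_nth [simp]: "fps_nth (map_coeffs f x) i = f (fps_nth x i)"
  by (simp add: map_coeffs_def)

lemma additive_map_coeffs: "additive f \<Longrightarrow> additive (map_coeffs f)"
  by (simp add: additive_def fps_eq_iff)

lemma additive_of_nat_mult:
  fixes f :: "'a::ring_1 \<Rightarrow> 'b::ring_1"
  assumes "additive f"
  shows "f (of_nat n * x) = of_nat n * f x"
  by (induction n) (simp_all add: additive.zero[OF assms] additive.add[OF assms] distrib_right)

lemma fps_deriv_map_coeffs:
  fixes f :: "'a::ring_1 \<Rightarrow> 'b::ring_1"
  assumes "additive f"
  shows "fps_deriv (map_coeffs f x) = map_coeffs f (fps_deriv x)"
  by (simp add: fps_eq_iff additive_of_nat_mult[OF assms] del: of_nat_Suc)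

lemma map_coeffs_mult:
  fixes f g k :: "_::ring \<Rightarrow> _::ring"
  assumes "additive k" "\<And>p q. k (p * q) = f p * g q"
  shows "map_coeffs k (x * y) = map_coeffs f x * map_coeffs g y"
  by (simp add: fps_eq_iff fps_mult_nth additive.sum[OF assms(1)] assms(2))

lemma map_coeffs_bracket:
  fixes f g k :: "_::ring \<Rightarrow> 'b::ring"
  assumes "additive k" "\<And>p q. comm (f p) (g q) = k (m p * n q)"
  shows "comm (map_coeffs f x) (map_coeffs g y) = map_coeffs k (map_coeffs m x * map_coeffs n y)"
proof (rule fps_ext)
  fix N
  \<comment> \<open>Reversing this convolution pairs the same coefficients of \<open>x\<close> and
    \<open>y\<close> as in the other product, so the commutator becomes a sum of brackets of
    coefficients.\<close>
  have "fps_nth (map_coeffs g y * map_coeffs f x) N = (\<Sum>i=0..N. g (fps_nth y (N - i)) * f (fps_nth x i))"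
    by (simp add: fps_mult_nth)
      (rule sum.reindex_bij_witness[of _ "\<lambda>i. N - i" "\<lambda>i. N - i"]; simp)
  then show "fps_nth (comm (map_coeffs f x) (map_coeffs g y)) N =
      fps_nth (map_coeffs k (map_coeffs m x * map_coeffs n y)) N"
    by (simp add: fps_mult_nth additive.sum[OF assms(1)] assms(2)[symmetric] sum_subtractf)
qed

lemma map2_bracket:
  fixes f g k :: "_::ring \<Rightarrow> 'b::ring"
  assumes "additive k" "\<And>p q. comm (f p) (g q) = k (m p * n q)"
  shows "comm (map2 f x) (map2 g y) = map2 k (map2 m x * map2 n y)"
  by (intro map_coeffs_bracket additive_map_coeffs assms)


section \<open>Limits of double power series\<close>

text \<open>Convergence in the \<open>(u, v)\<close>-adic topology: below any degree, the finitely
  many coefficients become stationary. Infinite series are handled through their partial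
  sums.\<close>

definition coeff_lim :: "(nat \<Rightarrow> 'a fps fps) \<Rightarrow> 'a fps fps \<Rightarrow> bool" where
  "coeff_lim F s \<longleftrightarrow> (\<forall>i j. eventually (\<lambda>M. coeff2 (F M) i j = coeff2 s i j) sequentially)"

lemma coeff_lim_unique:
  assumes "coeff_lim F s" "coeff_lim F t"
  shows "s = t"
proof (intro fps_ext)
  fix i j
  have "eventually (\<lambda>M. coeff2 s i j = coeff2 t i j) sequentially"
    using assms[unfolded coeff_lim_def, rule_format, of i j] by eventually_elim simp
  then show "coeff2 s i j = coeff2 t i j" by simp
qed

lemma coeff_lim_const: "coeff_lim (\<lambda>_. s) s"
  by (simp add: coeff_lim_def)

lemma coeff_lim_add:
  fixes F :: "nat \<Rightarrow> 'a::monoid_add fps fps"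
  assumes "coeff_lim F s" "coeff_lim G t"
  shows "coeff_lim (\<lambda>M. F M + G M) (s + t)"
  unfolding coeff_lim_def
proof (intro allI)
  fix i j
  from assms have "eventually (\<lambda>M. coeff2 (F M) i j = coeff2 s i j) sequentially"
    "eventually (\<lambda>M. coeff2 (G M) i j = coeff2 t i j) sequentially"
    by (simp_all add: coeff_lim_def)
  then show "eventually (\<lambda>M. coeff2 (F M + G M) i j = coeff2 (s + t) i j) sequentially"
    by eventually_elim simp
qed

lemma coeff_lim_sum:
  fixes F :: "'b \<Rightarrow> nat \<Rightarrow> 'a::comm_monoid_add fps fps"
  assumes "\<And>k. k \<in> A \<Longrightarrow> coeff_lim (F k) (s k)"
  shows "coeff_lim (\<lambda>M. \<Sum>k\<in>A. F k M) (\<Sum>k\<in>A. s k)"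
  using assms
  by (induction A rule: infinite_finite_induct) (simp_all add: coeff_lim_const coeff_lim_add)

lemma coeff_lim_mult:
  fixes F :: "nat \<Rightarrow> 'a::semiring_0 fps fps"
  assumes "coeff_lim F s" "coeff_lim G t"
  shows "coeff_lim (\<lambda>M. F M * G M) (s * t)"
  unfolding coeff_lim_def
proof (intro allI)
  fix i j
  \<comment> \<open>A coefficient of the product involves only finitely many coefficients of the
    factors, so one threshold serves for all of them.\<close>
  have "eventually (\<lambda>M. \<forall>a\<in>{..i}. \<forall>b\<in>{..j}. coeff2 (F M) a b = coeff2 s a b) sequentially"
    "eventually (\<lambda>M. \<forall>a\<in>{..i}. \<forall>b\<in>{..j}. coeff2 (G M) a b = coeff2 t a b) sequentially"
    using assms by (auto simp: coeff_lim_def intro!: eventually_ball_finite)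
  then show "eventually (\<lambda>M. coeff2 (F M * G M) i j = coeff2 (s * t) i j) sequentially"
    by eventually_elim (simp add: fps_mult_nth fps_sum_nth)
qed

lemma of_nat_mult_nth: "fps_nth (of_nat n * x) i = of_nat n * fps_nth (x :: 'a::ring_1 fps) i"
  by (simp flip: fps_of_nat)

lemma coeff_lim_deriv:
  fixes F :: "nat \<Rightarrow> 'a::ring_1 fps fps"
  assumes "coeff_lim F s"
  shows "coeff_lim (\<lambda>M. fps_deriv (F M)) (fps_deriv s)"
  unfolding coeff_lim_def
proof (intro allI)
  fix i j
  from assms have "eventually (\<lambda>M. coeff2 (F M) (Suc i) j = coeff2 s (Suc i) j) sequentially"
    by (simp add: coeff_lim_def)
  then show "eventually (\<lambda>M. coeff2 (fps_deriv (F M)) i j = coeff2 (fps_deriv s) i j) sequentially"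
    by eventually_elim (simp add: of_nat_mult_nth del: of_nat_Suc)
qed

lemma coeff_lim_subseq:
  assumes "coeff_lim F s" "filterlim r sequentially sequentially"
  shows "coeff_lim (\<lambda>M. F (r M)) s"
  unfolding coeff_lim_def
  by (intro allI eventually_compose_filterlim[OF _ assms(2)]) (use assms(1) in \<open>simp add: coeff_lim_def\<close>)

text \<open>Each factor \<open>z\<close> raises the total degree in \<open>u\<close> and
  \<open>v\<close> by at least one.\<close>

lemma coeff2_power_eq_0:
  fixes z :: "'a::ring_1 fps fps"
  assumes "coeff2 z 0 0 = 0"
  shows "i + j < n \<Longrightarrow> coeff2 (z ^ n) i j = 0"
proof (induction n arbitrary: i j)
  case (Suc n)
  have "coeff2 z a b * coeff2 (z ^ n) (i - a) (j - b) = 0" if "a \<le> i" "b \<le> j" for a b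
    using Suc that assms by (cases "a = 0 \<and> b = 0") auto
  then show ?case by (simp add: fps_mult_nth fps_sum_nth)
qed simp

lemma coeff_lim_power_0:
  fixes z :: "'a::ring_1 fps fps"
  assumes "coeff2 z 0 0 = 0"
  shows "coeff_lim (\<lambda>n. z ^ n) 0"
  unfolding coeff_lim_def
proof (intro allI)
  fix i j
  show "eventually (\<lambda>n. coeff2 (z ^ n) i j = coeff2 0 i j) sequentially"
    using eventually_gt_at_top[of "i + j"]
    by eventually_elim (simp add: coeff2_power_eq_0[OF assms])
qed

text \<open>The terms cut off in \<open>subst2\<close> contribute nothing to the coefficient in
  question, so the finite sums there describe the genuine infinite sum.\<close>

lemma coeff_lim_subst2:
  fixes z :: "'a::ring_1 fps fps"
  assumes "coeff2 z 0 0 = 0"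
  shows "coeff_lim (\<lambda>M. \<Sum>n<M. const2 (\<iota> (fps_nth f n)) * z ^ n) (subst2 \<iota> f z)"
  unfolding coeff_lim_def
proof (intro allI)
  fix i j
  show "eventually (\<lambda>M. coeff2 (\<Sum>n<M. const2 (\<iota> (fps_nth f n)) * z ^ n) i j =
      coeff2 (subst2 \<iota> f z) i j) sequentially"
    using eventually_gt_at_top[of "i + j"]
  proof eventually_elim
    case (elim M)
    have "(\<Sum>n\<le>i + j. \<iota> (fps_nth f n) * coeff2 (z ^ n) i j) =
        (\<Sum>n<M. \<iota> (fps_nth f n) * coeff2 (z ^ n) i j)"
      by (rule sum.mono_neutral_left) (use elim in \<open>auto simp: coeff2_power_eq_0[OF assms]\<close>)
    then show ?case by (simp add: subst2_def fps_sum_nth)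
  qed
qed


section \<open>Exponentials\<close>

lemma env_torsion_free:
  assumes "of_nat (Suc n) * a = of_nat (Suc n) * (b :: env)"
  shows "a = b"
proof -
  have "env_const (1 / of_nat (Suc n)) * of_nat (Suc n) = 1"
    by (simp only: env_const_of_nat[symmetric] env_const_simps(2)[symmetric])
      (simp add: env_const_simps(4) del: of_nat_Suc)
  then show ?thesis using arg_cong[OF assms, of "\<lambda>x. env_const (1 / of_nat (Suc n)) * x"]
    by (simp only: mult.assoc[symmetric] mult_1)
qed

lemma fps_torsion_free:
  fixes x y :: "'a::ring_1 fps"
  assumes "\<And>a b :: 'a. of_nat n * a = of_nat n * b \<Longrightarrow> a = b" "of_nat n * x = of_nat n * y"
  shows "x = y"
  by (rule fps_ext, rule assms(1)) (simp only: of_nat_mult_nth[symmetric] assms(2))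

lemma env1_torsion_free: "of_nat (Suc n) * a = of_nat (Suc n) * (b :: env fps) \<Longrightarrow> a = b"
  using env_torsion_free by (rule fps_torsion_free)

lemma env2_torsion_free: "of_nat (Suc n) * a = of_nat (Suc n) * (b :: env fps fps) \<Longrightarrow> a = b"
  using env1_torsion_free by (rule fps_torsion_free)

text \<open>Up to the factor \<open>n + 1\<close>, which can be cancelled, coefficient
  \<open>n + 1\<close> in \<open>u\<close> is coefficient \<open>n\<close> of the derivative. So all
  of them follow recursively from the initial one, which is still a series in
  \<open>v\<close>.\<close>

lemma ode_unique:
  fixes F G :: "env fps fps"
  assumes "\<And>n. (\<And>m. m \<le> n \<Longrightarrow> fps_nth F m = fps_nth G m) \<Longrightarrow>
      fps_nth (fps_deriv F) n = fps_nth (fps_deriv G) n"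
    and "fps_nth F 0 = fps_nth G 0"
  shows "F = G"
proof (rule fps_ext)
  fix n
  show "fps_nth F n = fps_nth G n"
  proof (induction n rule: less_induct)
    case (less n)
    show ?case
    proof (cases n)
      case (Suc m)
      have "fps_nth (fps_deriv F) m = fps_nth (fps_deriv G) m"
        by (rule assms(1)) (use less Suc in auto)
      then have "of_nat (Suc m) * fps_nth F n = of_nat (Suc m) * fps_nth G n" by (simp add: Suc)
      then show ?thesis by (rule env1_torsion_free)
    qed (simp add: assms(2))
  qed
qed

lemma ode_unique_left:
  fixes F G :: "env fps fps"
  assumes "fps_deriv F = a * F" "fps_deriv G = a * G" "fps_nth F 0 = fps_nth G 0"
  shows "F = G"
  by (rule ode_unique) (simp_all add: assms fps_mult_nth)

lemma ode_unique_right: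
  fixes F G :: "env fps fps"
  assumes "fps_deriv F = F * a" "fps_deriv G = G * a" "fps_nth F 0 = fps_nth G 0"
  shows "F = G"
  by (rule ode_unique) (simp_all add: assms fps_mult_nth)

section \<open>Divided powers and the exponential\<close>

definition divpow :: "env fps fps \<Rightarrow> nat \<Rightarrow> env fps fps" where
  "divpow z n = const2 (env_const (1 / fact n)) * z ^ n"

lemma const2_central: "const2 (env_const q) * a = a * const2 (env_const q)"
  by (simp add: fps_eq_iff env_const_central)

lemma divpow_0 [simp]: "divpow z 0 = 1"
  by (simp add: divpow_def env_const_simps(4))

lemma divpow_Suc_right: "divpow z n * z = of_nat (Suc n) * divpow z (Suc n)"
proof -
  have "(of_nat (Suc n) :: env fps fps) * const2 (env_const (1 / fact (Suc n))) =
      const2 (env_const (of_nat (Suc n)) * env_const (1 / fact (Suc n)))"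
    unfolding env_const_of_nat by (simp flip: fps_of_nat del: of_nat_Suc)
  also have "\<dots> = const2 (env_const (1 / fact n))"
    by (simp only: env_const_simps(2)[symmetric] fact_Suc)
      (simp add: of_nat_neq_0 del: of_nat_Suc)
  finally show ?thesis
    unfolding divpow_def mult.assoc[symmetric] by (simp only: mult.assoc power_Suc2)
qed

lemma divpow_Suc_left: "z * divpow z n = of_nat (Suc n) * divpow z (Suc n)"
proof -
  have "z * divpow z n = divpow z n * z"
    unfolding divpow_def mult.assoc[symmetric] const2_central[symmetric]
    by (simp add: mult.assoc power_commutes)
  then show ?thesis by (simp only: divpow_Suc_right)
qed

lemma coeff_lim_exp_env:
  "coeff2 z 0 0 = 0 \<Longrightarrow> coeff_lim (\<lambda>M. \<Sum>n<M. divpow z n) (exp_env z)"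
  using coeff_lim_subst2[of z env_const "fps_exp 1"]
  by (simp add: exp_env_def divpow_def fps_exp_def)

lemma fps_deriv_of_nat_mult: "fps_deriv (of_nat n * x) = of_nat n * fps_deriv (x :: 'a::ring_1 fps)"
  by simp

text \<open>The power rule, which relies on \<open>z\<close> commuting with its derivative. The
  induction goes through \<open>divpow z (Suc n) * z\<close>, and the factor \<open>n + 2\<close> is
  cancelled at the end.\<close>

lemma fps_deriv_divpow:
  assumes "comm (fps_deriv z) z = 0"
  shows "fps_deriv (divpow z (Suc n)) = divpow z n * fps_deriv z"
proof (induction n)
  case 0
  show ?case using divpow_Suc_left[of z 0] by simp
next
  case (Suc n)
  have "of_nat (Suc (Suc n)) * fps_deriv (divpow z (Suc (Suc n))) = fps_deriv (divpow z (Suc n) * z)"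
    by (simp only: divpow_Suc_right fps_deriv_of_nat_mult)
  also have "\<dots> = divpow z (Suc n) * fps_deriv z + divpow z n * fps_deriv z * z"
    by (simp add: Suc)
  also have "divpow z n * fps_deriv z * z = of_nat (Suc n) * divpow z (Suc n) * fps_deriv z"
    using assms by (simp add: mult.assoc flip: divpow_Suc_right del: of_nat_Suc)
  finally have "of_nat (Suc (Suc n)) * fps_deriv (divpow z (Suc (Suc n))) =
      of_nat (Suc (Suc n)) * (divpow z (Suc n) * fps_deriv z)"
    by (simp add: algebra_simps)
  then show ?case by (rule env2_torsion_free)
qed

lemma fps_deriv_exp_env:
  assumes "coeff2 z 0 0 = 0" "comm (fps_deriv z) z = 0"
  shows "fps_deriv (exp_env z) = exp_env z * fps_deriv z"
proof (rule coeff_lim_unique)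
  \<comment> \<open>The term \<open>n = 0\<close> has derivative 0, so \<open>M + 1\<close> terms of
    the exponential series yield exactly \<open>M\<close> terms of it.\<close>
  have "coeff_lim (\<lambda>M. fps_deriv (\<Sum>n<Suc M. divpow z n)) (fps_deriv (exp_env z))"
    by (intro coeff_lim_deriv coeff_lim_subseq[OF coeff_lim_exp_env] filterlim_Suc assms)
  also have "(\<lambda>M. fps_deriv (\<Sum>n<Suc M. divpow z n)) = (\<lambda>M. (\<Sum>n<M. divpow z n) * fps_deriv z)"
    by (simp add: sum.lessThan_Suc_shift fps_deriv_sum fps_deriv_divpow[OF assms(2)] sum_distrib_right
        del: sum.lessThan_Suc)
  finally show "coeff_lim (\<lambda>M. (\<Sum>n<M. divpow z n) * fps_deriv z) (fps_deriv (exp_env z))" .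
  show "coeff_lim (\<lambda>M. (\<Sum>n<M. divpow z n) * fps_deriv z) (exp_env z * fps_deriv z)"
    by (intro coeff_lim_mult coeff_lim_exp_env coeff_lim_const assms)
qed

text \<open>Up to division by \<open>k!\<close>, \<open>y k\<close> is the \<open>k\<close>-fold
  bracket of \<open>y 0\<close> with \<open>z\<close>; the formula is the Leibniz rule for moving
  \<open>y 0\<close> to the right through a divided power.\<close>

lemma divpow_commute:
  assumes "\<And>k. comm (y k) z = of_nat (Suc k) * y (Suc k)"
  shows "y 0 * divpow z n = (\<Sum>k\<le>n. divpow z (n - k) * y k)"
proof (induction n)
  case (Suc n)
  have yz: "y k * z = z * y k + of_nat (Suc k) * y (Suc k)" for k
    using assms[of k] by (simp add: algebra_simps)
  have "of_nat (Suc n) * (y 0 * divpow z (Suc n)) = (y 0 * divpow z n) * z"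
    by (metis mult.assoc divpow_Suc_right mult_of_nat_commute)
  also have "\<dots> = (\<Sum>k\<le>n. divpow z (n - k) * (y k * z))"
    by (simp add: Suc sum_distrib_right mult.assoc)
  also have "\<dots> = (\<Sum>k\<le>n. divpow z (n - k) * z * y k) + (\<Sum>k\<le>n. divpow z (n - k) * (of_nat (Suc k) * y (Suc k)))"
    unfolding yz distrib_left sum.distrib mult.assoc ..
  also have "(\<Sum>k\<le>n. divpow z (n - k) * z * y k) = (\<Sum>k\<le>n. of_nat (Suc n - k) * (divpow z (Suc n - k) * y k))"
    by (rule sum.cong) (auto simp: divpow_Suc_right Suc_diff_le mult.assoc simp del: of_nat_Suc)
  \<comment> \<open>The added term \<open>k = Suc n\<close> has weight 0.\<close>
  also have "\<dots> = (\<Sum>k\<le>Suc n. of_nat (Suc n - k) * (divpow z (Suc n - k) * y k))"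
    by simp
  \<comment> \<open>The index is shifted by one; the added term \<open>k = 0\<close> has weight
    0.\<close>
  also have "(\<Sum>k\<le>n. divpow z (n - k) * (of_nat (Suc k) * y (Suc k))) =
      (\<Sum>k\<le>Suc n. of_nat k * (divpow z (Suc n - k) * y k))"
  proof -
    have "divpow z (n - k) * (of_nat (Suc k) * y (Suc k)) =
        of_nat (Suc k) * (divpow z (n - k) * y (Suc k))" for k
      by (metis mult.assoc mult_of_nat_commute)
    then show ?thesis by (simp add: sum.atMost_Suc_shift del: sum.atMost_Suc of_nat_Suc)
  qed
  \<comment> \<open>The two weights \<open>n + 1 - k\<close> and \<open>k\<close> add up to
    \<open>n + 1\<close>.\<close>
  also have "(\<Sum>k\<le>Suc n. of_nat (Suc n - k) * (divpow z (Suc n - k) * y k)) + \<dots> =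
      (\<Sum>k\<le>Suc n. of_nat (Suc n) * (divpow z (Suc n - k) * y k))"
    unfolding sum.distrib[symmetric] 
    by (rule sum.cong) (simp_all flip: distrib_right of_nat_add)
  finally have "of_nat (Suc n) * (y 0 * divpow z (Suc n)) =
      of_nat (Suc n) * (\<Sum>k\<le>Suc n. divpow z (Suc n - k) * y k)"
    by (simp only: sum_distrib_left)
  then show ?case by (rule env2_torsion_free)
qed simp

text \<open>This is \<open>exp(-z) y exp(z) = exp(-ad z) y\<close>, a finite sum because the
  iterated brackets vanish beyond \<open>K\<close>.\<close>

lemma exp_env_commute:
  assumes z: "coeff2 z 0 0 = 0" and y: "\<And>k. comm (y k) z = of_nat (Suc k) * y (Suc k)"
    and y0: "\<And>k. k > K \<Longrightarrow> y k = 0"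
  shows "y 0 * exp_env z = exp_env z * (\<Sum>k\<le>K. y k)"
proof (rule coeff_lim_unique)
  let ?E = "\<lambda>M. \<Sum>n<M. divpow z n"
  \<comment> \<open>Only \<open>M - k\<close> terms are left in front of \<open>y k\<close>; for
    \<open>k \<ge> M\<close> the truncated subtraction makes that sum empty.\<close>
  have "y 0 * ?E M = (\<Sum>k\<le>K. ?E (M - k) * y k)" for M
  proof (induction M)
    case (Suc M)
    have "y 0 * divpow z M = (\<Sum>k\<le>M. divpow z (M - k) * y k)"
      by (rule divpow_commute) (rule y)
    also have "\<dots> = (\<Sum>k\<le>max K M. if k \<le> M then divpow z (M - k) * y k else 0)"
      by (rule sum.mono_neutral_cong_left) auto
    also have "\<dots> = (\<Sum>k\<le>K. if k \<le> M then divpow z (M - k) * y k else 0)"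
      by (rule sum.mono_neutral_right) (auto simp: y0)
    finally have "y 0 * ?E (Suc M) = (\<Sum>k\<le>K. ?E (M - k) * y k + (if k \<le> M then divpow z (M - k) * y k else 0))"
      by (simp add: distrib_left Suc sum.distrib)
    also have "\<dots> = (\<Sum>k\<le>K. ?E (Suc M - k) * y k)"
      by (rule sum.cong) (auto simp: Suc_diff_le distrib_right not_le)
    finally show ?case .
  qed simp
  moreover have "coeff_lim (\<lambda>M. y 0 * ?E M) (y 0 * exp_env z)"
    by (intro coeff_lim_mult coeff_lim_const coeff_lim_exp_env z)
  ultimately show "coeff_lim (\<lambda>M. \<Sum>k\<le>K. ?E (M - k) * y k) (y 0 * exp_env z)"
    by simp
  have "coeff_lim (\<lambda>M. \<Sum>k\<le>K. ?E (M - k) * y k) (\<Sum>k\<le>K. exp_env z * y k)"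
    by (intro coeff_lim_sum coeff_lim_mult coeff_lim_const coeff_lim_subseq[OF coeff_lim_exp_env] z
        filterlim_minus_const_nat_at_top)
  then show "coeff_lim (\<lambda>M. \<Sum>k\<le>K. ?E (M - k) * y k) (exp_env z * (\<Sum>k\<le>K. y k))"
    by (simp add: sum_distrib_left)
qed

text \<open>Three brackets are enough for the factorisation: bracketing \<open>x\<^sup>+\<close>
  repeatedly with \<open>x\<^sup>-\<close> gives \<open>h\<close>, then \<open>x\<^sup>-\<close>,
  then \<open>X\<^sup>-\<close>, then 0. The factors 2 and 3 account for the division by
  \<open>k!\<close>.\<close>

lemma exp_env_commute3:
  assumes "coeff2 z 0 0 = 0"
    and "comm a z = b" "comm b z = 2 * c" "comm c z = 3 * d" "comm d z = 0"
  shows "a * exp_env z = exp_env z * (a + b + c + d)"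
proof -
  define y where "y k = (if k = 0 then a else if k = 1 then b else if k = 2 then c
    else if k = 3 then d else 0)" for k :: nat
  have "comm (y k) z = of_nat (Suc k) * y (Suc k)" for k
    using assms(2-5) by (auto simp: y_def numeral_eq_Suc)
  from exp_env_commute[OF assms(1) this, of 3] show ?thesis
    by (simp add: y_def numeral_eq_Suc)
qed

lemma exp_env_commute0:
  assumes "coeff2 z 0 0 = 0" "comm a z = 0"
  shows "a * exp_env z = exp_env z * a"
  using exp_env_commute3[OF assms(1), of a 0 0 0] assms(2) by simp

lemma power_nth_0: "fps_nth (z ^ n) 0 = (fps_nth z 0 :: 'a::ring_1) ^ n"
  by (induction n) (simp_all add: fps_mult_nth_0)

text \<open>Setting \<open>u = 0\<close> is multiplicative, hence compatible with the powers of
  \<open>z\<close>.\<close>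

lemma exp_env_nth_0_cong:
  assumes "fps_nth z 0 = fps_nth z' 0"
  shows "fps_nth (exp_env z) 0 = fps_nth (exp_env z') 0"
  by (simp add: exp_env_def subst2_def power_nth_0 assms)

lemma exp_env_0: "exp_env 0 = 1"
proof (rule coeff_lim_unique)
  show "coeff_lim (\<lambda>M. \<Sum>n<Suc M. divpow 0 n) (exp_env 0)"
    by (intro coeff_lim_subseq[OF coeff_lim_exp_env] filterlim_Suc) simp
  have "(\<Sum>n<Suc M. divpow 0 n) = 1" for M
    by (simp add: sum.lessThan_Suc_shift divpow_def[of _ "Suc _"] del: sum.lessThan_Suc)
  then show "coeff_lim (\<lambda>M. \<Sum>n<Suc M. divpow 0 n) 1"
    by (simp add: coeff_lim_const del: sum.lessThan_Suc)
qed

lemma exp_env_nth_0: "fps_nth z 0 = 0 \<Longrightarrow> fps_nth (exp_env z) 0 = 1"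
  using exp_env_nth_0_cong[of z 0] by (simp add: exp_env_0)

text \<open>The derivatives of the partial sums are geometric sums in \<open>- z\<close>.
  Multiplication by \<open>1 + z\<close> telescopes them and leaves a remainder with factor
  \<open>(- z) ^ M\<close>, which tends to 0.\<close>

lemma fps_deriv_ln1p:
  assumes "coeff2 z 0 0 = 0"
  shows "fps_deriv (ln1p z) * (1 + z) = fps_deriv z"
proof (rule coeff_lim_unique)
  let ?p = "\<lambda>n. const2 [:fps_nth (fps_ln 1) n:] * z ^ n"
  have d: "fps_deriv (?p (Suc n)) = (- z) ^ n * fps_deriv z" for n
  proof -
    have "const2 [:fps_nth (fps_ln 1) (Suc n):] * (of_nat (Suc n)) = (-1 :: rat poly fps fps) ^ n"
    proof -
      have "const2 [:fps_nth (fps_ln 1) (Suc n):] * of_nat (Suc n) =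
          const2 ([:fps_nth (fps_ln 1) (Suc n):] * (of_nat (Suc n) :: rat poly))"
        by (simp flip: fps_of_nat del: of_nat_Suc)
      also have "[:fps_nth (fps_ln 1) (Suc n):] * (of_nat (Suc n) :: rat poly) = (-1) ^ n"
        by (cases "even n") (simp_all add: fps_ln_nth of_nat_poly pCons_one del: of_nat_Suc, simp add: one_pCons)
      also have "const2 ((-1 :: rat poly) ^ n) = (-1) ^ n"
        by (cases "even n") (simp_all flip: fps_const_neg)
      finally show ?thesis .
    qed
    moreover have "fps_deriv (z ^ Suc n) = of_nat (Suc n) * (z ^ n * fps_deriv z)"
      by (simp add: fps_deriv_power' mult_ac del: power_Suc of_nat_Suc)
    ultimately have "fps_deriv (?p (Suc n)) = (-1) ^ n * (z ^ n * fps_deriv z)"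
      by (simp only: fps_deriv_mult_const_left mult.assoc[symmetric])
    then show ?thesis
      by (simp only: power_minus[of z] mult.assoc)
  qed
  have "coeff_lim (\<lambda>M. fps_deriv (\<Sum>n<Suc M. ?p n) * (1 + z)) (fps_deriv (ln1p z) * (1 + z))"
    unfolding ln1p_def
    by (intro coeff_lim_deriv coeff_lim_mult coeff_lim_const coeff_lim_subseq[OF coeff_lim_subst2] filterlim_Suc assms)
  also have "(\<lambda>M. fps_deriv (\<Sum>n<Suc M. ?p n) * (1 + z)) = (\<lambda>M. fps_deriv z + - ((- z) ^ M * fps_deriv z))"
  proof
    fix M
    have "fps_deriv (\<Sum>n<Suc M. ?p n) * (1 + z) = (1 - (- z)) * (\<Sum>n<M. (- z) ^ n) * fps_deriv z"
      by (simp only: sum.lessThan_Suc_shift fps_deriv_add fps_deriv_sum d sum_distrib_right[symmetric])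
         (simp add: mult_ac)
    also have "\<dots> = fps_deriv z + - ((- z) ^ M * fps_deriv z)"
      by (simp only: one_diff_power_eq[symmetric]) (simp add: algebra_simps)
    finally show "fps_deriv (\<Sum>n<Suc M. ?p n) * (1 + z) = \<dots>" .
  qed
  finally show "coeff_lim (\<lambda>M. fps_deriv z + - ((- z) ^ M * fps_deriv z)) (fps_deriv (ln1p z) * (1 + z))" .
  have "coeff_lim (\<lambda>M. fps_deriv z + (- z) ^ M * (- fps_deriv z)) (fps_deriv z + 0 * - fps_deriv z)"
    by (intro coeff_lim_add coeff_lim_mult coeff_lim_const coeff_lim_power_0) (simp add: assms)
  then show "coeff_lim (\<lambda>M. fps_deriv z + - ((- z) ^ M * fps_deriv z)) (fps_deriv z)"
    by simp
qed


section \<open>The action of series on \<open>L\<close>\<close>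

lemma L_to_env_superset:
  "finite A \<Longrightarrow> Poly_Mapping.keys y \<subseteq> A \<Longrightarrow>
    L_to_env y = (\<Sum>b\<in>A. env_const (Poly_Mapping.lookup y b) * env_gen (incl_gen b))"
  unfolding L_to_env_def by (rule sum.mono_neutral_left) (auto simp: in_keys_iff env_const_simps(3))

lemma L_to_env_add: "L_to_env (y + z) = L_to_env y + L_to_env z"
proof -
  let ?A = "Poly_Mapping.keys y \<union> Poly_Mapping.keys z"
  have "Poly_Mapping.keys (y + z) \<subseteq> ?A" by (rule Poly_Mapping.keys_add)
  then show ?thesis
    using L_to_env_superset[of ?A y] L_to_env_superset[of ?A z] L_to_env_superset[of ?A "y + z"]
    by (simp add: lookup_add env_const_simps(1) distrib_right sum.distrib)
qed

lemma L_to_env_0 [simp]: "L_to_env 0 = 0"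
  by (simp add: L_to_env_def)

lemma L_to_env_sum: "L_to_env (\<Sum>k\<in>A. f k) = (\<Sum>k\<in>A. L_to_env (f k))"
  by (induction A rule: infinite_finite_induct) (simp_all add: L_to_env_add)

lemma lookup_L_scale: "Poly_Mapping.lookup (L_scale q y) b = q * Poly_Mapping.lookup y b"
  by (simp add: L_scale_def Poly_Mapping.map.rep_eq when_def)

lemma L_to_env_scale: "L_to_env (L_scale q y) = env_const q * L_to_env y"
proof -
  have "Poly_Mapping.keys (L_scale q y) \<subseteq> Poly_Mapping.keys y"
    by (auto simp: in_keys_iff lookup_L_scale)
  from L_to_env_superset[OF finite_keys this] show ?thesis
    by (simp add: L_to_env_def lookup_L_scale env_const_simps(2) sum_distrib_left mult.assoc)
qed

lemma L_to_env_poly_act: "L_to_env (poly_act p y) = lin (\<lambda>n. L_to_env ((w_act ^^ n) y)) p"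
  by (simp add: poly_act_def lin_def L_to_env_sum L_to_env_scale)

lemma L_to_env_single: "L_to_env (Poly_Mapping.single b q) = env_const q * env_gen (incl_gen b)"
  by (cases "q = 0") (simp_all add: L_to_env_def env_const_simps(3))

lemma w_act_single: "w_act (Poly_Mapping.single b q) = L_scale q (w_gen b)"
proof -
  have "L_scale 0 x = 0" for x by (rule poly_mapping_eqI) (simp add: lookup_L_scale)
  then show ?thesis by (cases "q = 0") (simp_all add: w_act_def)
qed

lemma L_scale_single: "L_scale q (Poly_Mapping.single b r) = Poly_Mapping.single b (q * r)"
  by (rule poly_mapping_eqI) (simp add: lookup_L_scale lookup_single when_def)

lemma w_act_power:
  "(w_act ^^ n) (L_gen (Lh k)) = L_gen (Lh (k + n))"
  "(w_act ^^ n) (L_gen (Lx \<sigma> k)) = L_gen (Lx \<sigma> (k + n))"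
  "(w_act ^^ n) (L_gen (LX \<sigma> k)) = Poly_Mapping.single (LX \<sigma> (k + n)) ((-1) ^ n)"
  by (induction n) (simp_all add: w_act_single L_scale_single single_uminus[symmetric])

abbreviation hh :: "rat poly fps fps \<Rightarrow> env fps fps" where "hh \<equiv> map2 (lin gh)"
abbreviation xx :: "pm \<Rightarrow> rat poly fps fps \<Rightarrow> env fps fps" where "xx \<sigma> \<equiv> map2 (lin (gx \<sigma>))"
abbreviation XX :: "pm \<Rightarrow> rat poly fps fps \<Rightarrow> env fps fps" where "XX \<sigma> \<equiv> map2 (lin (gX \<sigma>))"

text \<open>Since \<open>w\<^sup>r.X\<^sub>1 = (-1)\<^sup>r X\<^sub>2\<^sub>r\<^sub>+\<^sub>1\<close>, the action of \<open>w\<close> on \<open>X\<^sub>1\<close> is multiplication by \<open>- w\<^sup>2\<close> once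
  \<open>X\<^sub>n\<close> is labelled by \<open>w\<^sup>n\<close>.\<close>

definition neg_square :: "rat poly \<Rightarrow> rat poly" where "neg_square p = pcompose p [:0, 0, -1:]"

lemma neg_square_monom:
  "neg_square (Polynomial.monom c n) = Polynomial.monom (c * (-1) ^ n) (2 * n)"
proof (induction n)
  case 0
  then show ?case by (simp add: neg_square_def monom_0)
next
  case (Suc n)
  then show ?case by (simp add: neg_square_def monom_Suc pcompose_pCons smult_monom)
qed

lemma act_Lh: "\<xi> \<star> L_gen (Lh 0) = hh \<xi>"
proof -
  have "L_to_env (L_gen (Lh n)) = gh n" for n
    by (simp add: L_to_env_single env_const_simps(4) gh_def)
  then show ?thesis by (simp add: fps_eq_iff act_def L_to_env_poly_act w_act_power)
qed

lemma L_to_env_Lx: "L_to_env (L_gen (Lx \<sigma> n)) = gx \<sigma> n"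
  by (simp add: L_to_env_single env_const_simps(4) gx_def)

lemma act_Lx: "\<xi> \<star> L_gen (Lx \<sigma> 0) = xx \<sigma> \<xi>"
  by (simp add: fps_eq_iff act_def L_to_env_poly_act w_act_power L_to_env_Lx)

text \<open>Starting at \<open>x\<^sub>1\<close> instead of \<open>x\<^sub>0\<close> shifts all
  indices by one, which is multiplication of the label by \<open>w\<close>.\<close>

lemma act_Lx_1: "\<xi> \<star> L_gen (Lx \<sigma> 1) = xx \<sigma> (w * \<xi>)"
proof -
  have "lin (\<lambda>n. gx \<sigma> (Suc n)) p = lin (gx \<sigma>) ([:0, 1:] * p)" for p
  proof (rule additive_poly_eqI[where f = "lin (\<lambda>n. gx \<sigma> (Suc n))"])
    show "additive (\<lambda>p. lin (gx \<sigma>) ([:0, 1:] * p))"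
      by standard (simp only: distrib_left additive.add[OF additive_lin])
    have "[:0, 1:] * Polynomial.monom c n = Polynomial.monom c (Suc n)" for c :: rat and n
      by (simp add: monom_Suc)
    then show "lin (\<lambda>n. gx \<sigma> (Suc n)) (Polynomial.monom c n) = lin (gx \<sigma>) ([:0, 1:] * Polynomial.monom c n)"
      for c n by (simp only: lin_monom)
  qed (rule additive_lin)
  then show ?thesis
    by (simp add: fps_eq_iff act_def L_to_env_poly_act w_act_power L_to_env_Lx w_def)
qed

text \<open>The leading factor \<open>w\<close> is the label of \<open>X\<^sub>1\<close>.\<close>

lemma act_LX: "\<xi> \<star> L_gen (LX \<sigma> 0) = XX \<sigma> (w * map2 neg_square \<xi>)"
proof -
  have *: "L_to_env (Poly_Mapping.single (LX \<sigma> n) q) = env_const q * gX \<sigma> (Suc (2 * n))" for n q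
    by (simp add: L_to_env_single gX_def)
  have "lin (\<lambda>n. env_const ((-1) ^ n) * gX \<sigma> (Suc (2 * n))) p = lin (gX \<sigma>) ([:0, 1:] * neg_square p)" for p
  proof (rule additive_poly_eqI[where g = "\<lambda>p. lin (gX \<sigma>) ([:0, 1:] * neg_square p)"])
    show "additive (\<lambda>p. lin (gX \<sigma>) ([:0, 1:] * neg_square p))"
      by standard (simp only: distrib_left neg_square_def pcompose_add additive.add[OF additive_lin])
    have "[:0, 1:] * neg_square (Polynomial.monom c n) = Polynomial.monom (c * (-1) ^ n) (Suc (2 * n))"
      for c :: rat and n
      by (simp add: monom_Suc neg_square_monom)
    then show "lin (\<lambda>n. env_const ((-1) ^ n) * gX \<sigma> (Suc (2 * n))) (Polynomial.monom c n) =
        lin (gX \<sigma>) ([:0, 1:] * neg_square (Polynomial.monom c n))" for c n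
      by (simp only: lin_monom env_const_simps(2) mult.assoc)
  qed (rule additive_lin)
  then show ?thesis
    by (simp add: fps_eq_iff act_def L_to_env_poly_act w_act_power * w_def)
qed


section \<open>Brackets of series\<close>

lemma numeral_mult_nth: "fps_nth (numeral k * x) i = numeral k * fps_nth (x :: 'a::ring_1 fps) i"
  using of_nat_mult_nth[of "numeral k" x i] by simp

lemma additive_numeral_mult:
  fixes f :: "'a::ring_1 \<Rightarrow> 'b::ring_1"
  assumes "additive f"
  shows "f (numeral k * x) = numeral k * f x"
  using additive_of_nat_mult[OF assms, of "numeral k" x] by simp

lemma map2_id: "map2 (\<lambda>p. p) x = x"
  by (simp add: fps_eq_iff)

abbreviation flip2 :: "rat poly fps fps \<Rightarrow> rat poly fps fps" where "flip2 \<equiv> map2 sgn_flip"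

lemma map2_comb:
  "map2 (\<lambda>p. - sgn_flip p) x = - flip2 x"
  "map2 (\<lambda>p. 4 * p - 2 * sgn_flip p) x = 4 * x - 2 * flip2 x"
  "map2 (\<lambda>p. 2 * sgn_flip p - 4 * p) x = 2 * flip2 x - 4 * x"
  "map2 (\<lambda>p. - 2 * (p + sgn_flip p)) x = - (2 * (x + flip2 x))"
  "map2 (\<lambda>p. 2 * sgn_flip p) x = 2 * flip2 x"
  "map2 (\<lambda>p. p - sgn_flip p) x = x - flip2 x"
  by (simp_all add: fps_eq_iff numeral_mult_nth)

lemma comm_series:
  "comm (hh x) (xx Plus y) = xx Plus ((4 * x - 2 * flip2 x) * y)"
  "comm (hh x) (xx Minus y) = xx Minus ((2 * flip2 x - 4 * x) * y)"
  "comm (hh x) (XX Minus y) = XX Minus (- (2 * (x + flip2 x)) * y)"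
  "comm (xx Plus x) (xx Plus y) = XX Plus (x * flip2 y)"
  "comm (xx Minus x) (xx Minus y) = XX Minus (x * - flip2 y)"
  "comm (xx Plus x) (xx Minus y) = hh (x * y)"
  "comm (xx Plus x) (XX Minus y) = xx Minus (2 * flip2 x * (y - flip2 y))"
  using map2_bracket[of _ _ _ "\<lambda>p. 4 * p - 2 * sgn_flip p" "\<lambda>p. p" x y, OF additive_lin comm_lin(1)]
    map2_bracket[of _ _ _ "\<lambda>p. 2 * sgn_flip p - 4 * p" "\<lambda>p. p" x y, OF additive_lin comm_lin(2)]
    map2_bracket[of _ _ _ "\<lambda>p. - 2 * (p + sgn_flip p)" "\<lambda>p. p" x y, OF additive_lin comm_lin(3)]
    map2_bracket[of _ _ _ "\<lambda>p. p" sgn_flip x y, OF additive_lin comm_lin(4)]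
    map2_bracket[of _ _ _ "\<lambda>p. p" "\<lambda>p. - sgn_flip p" x y, OF additive_lin comm_lin(5)]
    map2_bracket[of _ _ _ "\<lambda>p. p" "\<lambda>p. p" x y, OF additive_lin comm_lin(6)]
    map2_bracket[of _ _ _ "\<lambda>p. 2 * sgn_flip p" "\<lambda>p. p - sgn_flip p" x y, OF additive_lin comm_lin(7)]
  unfolding map2_id map2_comb by blast+

lemma commute_series:
  "comm (hh x) (hh y) = 0" "comm (xx \<sigma> x) (XX \<sigma> y) = 0" "comm (XX \<sigma> x) (XX \<sigma> y) = 0"
  "comm (XX \<sigma> x) (xx \<sigma> y) = 0"
proof -
  have "map2 (\<lambda>_. 0 :: env) x = 0" for x :: "rat poly fps fps"
    by (simp add: fps_eq_iff)
  moreover have "additive (\<lambda>_. 0 :: env)" by standard simp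
  ultimately have *: "comm (map2 (lin f) x) (map2 (lin g) y) = 0"
    if "\<And>p q. comm (lin f p) (lin g q) = 0" for f g
    using map2_bracket[of "\<lambda>_. 0" "lin f" "lin g" "\<lambda>p. p" "\<lambda>p. p" x y] that by simp
  show "comm (hh x) (hh y) = 0" "comm (XX \<sigma> x) (XX \<sigma> y) = 0"
    "comm (xx \<sigma> x) (XX \<sigma> y) = 0" "comm (XX \<sigma> x) (xx \<sigma> y) = 0"
    by (rule *, simp add: commute_lin[THEN eq_iff_diff_eq_0[THEN iffD2]])+
qed

text \<open>Since \<open>gX\<close> lives on odd indices, \<open>flip2\<close> on the label negates
  the element. An even label therefore gives an element equal to its own negative, and 2 can be
  cancelled.\<close>

lemma XX_even_eq_0:
  assumes "flip2 x = x"
  shows "XX \<sigma> x = 0"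
proof -
  have "lin (gX \<sigma>) (sgn_flip p) = - lin (gX \<sigma>) p" for p
  proof (rule additive_poly_eqI[where f = "\<lambda>p. lin (gX \<sigma>) (sgn_flip p)"])
    show "additive (\<lambda>p. lin (gX \<sigma>) (sgn_flip p))"
      by standard (simp add: sgn_flip.add additive.add[OF additive_lin])
    show "additive (\<lambda>p. - lin (gX \<sigma>) p)"
      by standard (simp add: additive.add[OF additive_lin])
    show "lin (gX \<sigma>) (sgn_flip (Polynomial.monom c n)) = - lin (gX \<sigma>) (Polynomial.monom c n)" for c n
      by (cases "even n") (simp_all add: gX_def env_const.minus)
  qed
  then have "XX \<sigma> (flip2 x) = - XX \<sigma> x" by (simp add: fps_eq_iff)
  then have "XX \<sigma> x + XX \<sigma> x = 0" by (simp add: assms eq_neg_iff_add_eq_0)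
  then have "of_nat (Suc 1) * XX \<sigma> x = of_nat (Suc 1) * 0"
    by (simp add: mult_2)
  then show ?thesis by (rule env2_torsion_free)
qed

interpretation hh: additive hh by (intro additive_map_coeffs additive_lin)
interpretation xx: additive "xx \<sigma>" by (intro additive_map_coeffs additive_lin)
interpretation XX: additive "XX \<sigma>" by (intro additive_map_coeffs additive_lin)


section \<open>The series in the exponents\<close>

text \<open>Used to push the substitutions \<open>w \<mapsto> - w\<close> and
  \<open>w \<mapsto> - w\<^sup>2\<close> through rational expressions in \<open>u\<close>,
  \<open>v\<close>, \<open>w\<close>.\<close>

locale ring_map = additive f for f :: "'a::ring_1 \<Rightarrow> 'b::ring_1" +
  assumes mult: "f (x * y) = f x * f y" and one: "f 1 = 1"
begin

lemma power: "f (x ^ n) = f x ^ n"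
  by (induction n) (simp_all add: one mult)

lemma numeral: "f (numeral k) = numeral k"
  using additive_numeral_mult[OF additive_axioms, of k 1] by (simp add: one)

lemmas hom_simps = add diff minus zero mult one power numeral

end

lemma ring_map_map_coeffs:
  assumes "ring_map f"
  shows "ring_map (map_coeffs f)"
proof -
  interpret f: ring_map f by fact
  show ?thesis
  proof (intro ring_map.intro additive_map_coeffs f.additive_axioms ring_map_axioms.intro)
    show "map_coeffs f (x * y) = map_coeffs f x * map_coeffs f y" for x y
      by (intro map_coeffs_mult f.additive_axioms f.mult)
    show "map_coeffs f 1 = 1" by (simp add: fps_eq_iff f.one f.zero)
  qed
qed

lemma map2_u_v:
  assumes "ring_map f"
  shows "map2 f u = u" "map2 f v = v"
proof -
  interpret f: ring_map f by fact
  show "map2 f u = u" "map2 f v = v"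
    by (auto simp: fps_eq_iff u_def v_def fps_X_def f.one f.zero)
qed

interpretation flip2: ring_map flip2
proof (intro ring_map_map_coeffs)
  show "ring_map sgn_flip" by standard (simp_all add: sgn_flip_simps)
qed

interpretation neg_square2: ring_map "map2 neg_square"
proof (intro ring_map_map_coeffs)
  show "ring_map neg_square"
    by standard (simp_all add: neg_square_def pcompose_add pcompose_mult pcompose_1)
qed

lemma flip2_vars: "flip2 u = u" "flip2 v = v" "flip2 w = - w"
proof -
  have "ring_map sgn_flip" by standard (simp_all add: sgn_flip_simps)
  then show "flip2 u = u" "flip2 v = v" by (rule map2_u_v)+
  show "flip2 w = - w"
    by (simp add: fps_eq_iff w_def sgn_flip_def pcompose_pCons sgn_flip.zero[unfolded sgn_flip_def])
qed

lemma neg_square2_vars: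
  "map2 neg_square u = u" "map2 neg_square v = v" "map2 neg_square w = - (w ^ 2)"
proof -
  have "ring_map neg_square"
    by standard (simp_all add: neg_square_def pcompose_add pcompose_mult pcompose_1)
  then show "map2 neg_square u = u" "map2 neg_square v = v" by (rule map2_u_v)+
  show "map2 neg_square w = - (w ^ 2)"
    by (simp add: fps_eq_iff w_def neg_square_def pcompose_pCons power2_eq_square)
qed

lemma right_inverse_unique:
  fixes d :: "'a::comm_monoid_mult"
  assumes "d * r = 1" "d * r' = 1"
  shows "r = r'"
  by (metis assms mult.assoc mult.commute mult_1)

text \<open>The common denominator: \<open>alpha\<close> and \<open>gamma\<close> are taken at
  \<open>w\<^sup>2\<close>, and in \<open>beta\<close> the substitution
  \<open>w \<mapsto> - w\<^sup>2\<close> turns the sign of the middle term.\<close>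

definition den :: "rat poly fps fps" where "den = 1 - 6 * (w * u * v) ^ 2 + (w * u * v) ^ 4"
definition rden :: "rat poly fps fps" where "rden = recip den"

lemma den_nth_0: "fps_nth den 0 = 1"
  by (simp add: den_def u_def power_nth_0 fps_mult_nth_0)

lemma den_rden: "den * rden = 1"
  unfolding rden_def by (rule recip) (rule den_nth_0)

lemma rden_nth_0: "fps_nth rden 0 = 1"
  using arg_cong[OF den_rden, of "\<lambda>x. fps_nth x 0"] by (simp add: fps_mult_nth_0 den_nth_0)

lemma flip2_rden: "flip2 rden = rden"
proof -
  have "den * flip2 rden = 1"
    using arg_cong[OF den_rden, of flip2]
    by (simp add: den_def flip2.hom_simps flip2_vars)
  then show ?thesis using den_rden by (rule right_inverse_unique)
qed

lemma fps_deriv_vars: "fps_deriv u = 1" "fps_deriv v = 0" "fps_deriv w = 0"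
  by (simp_all add: u_def v_def w_def)

lemma fps_deriv_rden:
  "fps_deriv rden = w * v * (12 * (w * u * v) - 4 * (w * u * v) ^ 3) * rden ^ 2"
proof -
  have "fps_deriv den = - (w * v * (12 * (w * u * v) - 4 * (w * u * v) ^ 3))"
    by (simp add: den_def fps_deriv_power' fps_deriv_vars) (simp add: algebra_simps eval_nat_numeral)
  moreover have "den * fps_deriv rden = - (fps_deriv den * rden)"
    using arg_cong[OF den_rden, of fps_deriv] by (simp add: eq_neg_iff_add_eq_0)
  moreover have "fps_deriv rden = rden * (den * fps_deriv rden)"
    using den_rden by (simp add: mult.commute flip: mult.assoc)
  ultimately show ?thesis
    by (simp add: power2_eq_square mult_ac)
qed

text \<open>Labels of the exponents: \<open>zeta\<close>, \<open>bet\<close>, \<open>gam\<close> for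
  the three negative factors and \<open>del\<close>, \<open>bet'\<close>, \<open>alp\<close> for the
  three positive ones, in the order of the product. The prime in \<open>bet'\<close> does not denote
  a derivative.\<close>

definition zeta :: "rat poly fps fps" where
  "zeta = w * v * (1 + (w * u * v) ^ 2) * rden"
definition gam :: "rat poly fps fps" where
  "gam = w * v * ((w * u * v) ^ 3 - 3 * (w * u * v)) * rden"
definition bet :: "rat poly fps fps" where
  "bet = - ((w * v) ^ 2 * (w * u * v) * (1 + 4 * (w * u * v) ^ 2 - (w * u * v) ^ 4) * rden ^ 2)"
definition alp :: "rat poly fps fps" where
  "alp = u * (1 + (w * u * v) ^ 2) * rden"
definition del :: "rat poly fps fps" where
  "del = u * ((w * u * v) ^ 3 - 3 * (w * u * v)) * rden"
definition bet' :: "rat poly fps fps" where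
  "bet' = u ^ 2 * (w * u * v) * (1 + 4 * (w * u * v) ^ 2 - (w * u * v) ^ 4) * rden ^ 2"
text \<open>The factor by which conjugation with \<open>exp (\<eta>(w).h\<^sub>0)\<close> rescales \<open>x\<^sub>0\<^sup>+\<close>: it equals
  \<open>q / p\<^sup>2\<close>, where \<open>p q\<close> with \<open>p = 1 + 2wuv - w\<^sup>2u\<^sup>2v\<^sup>2\<close> and \<open>q = 1 - 2wuv - w\<^sup>2u\<^sup>2v\<^sup>2\<close> factors the denominator.\<close>

definition scl :: "rat poly fps fps" where
  "scl = (1 - 2 * (w * u * v) - (w * u * v) ^ 2) ^ 3 * rden ^ 2"

lemma recip_den_w2: "recip (1 - 6 * w\<^sup>2 * u^2 * v^2 + (w\<^sup>2)^2 * u^4 * v^4) = rden"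
  unfolding rden_def den_def by (rule arg_cong[where f = recip]) (simp add: eval_nat_numeral algebra_simps)

text \<open>A ring homomorphism maps inverses to inverses, and inverses are unique.\<close>

lemma neg_square2_recip:
  "map2 neg_square (recip ((1 + 6 * w * u^2 * v^2 + w^2 * u^4 * v^4)^2)) = rden ^ 2"
proof -
  let ?d = "(1 + 6 * w * u^2 * v^2 + w^2 * u^4 * v^4)^2"
  have "map2 neg_square ?d = den ^ 2"
    by (simp add: neg_square2.hom_simps neg_square2_vars den_def)
      (simp add: eval_nat_numeral algebra_simps)
  moreover have "map2 neg_square (?d * recip ?d) = 1"
    by (subst recip) (simp_all add: denominators neg_square2.one)
  ultimately have "den ^ 2 * map2 neg_square (recip ?d) = 1"
    by (simp only: neg_square2.mult)
  moreover have "den ^ 2 * rden ^ 2 = 1"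
    by (simp add: den_rden flip: power_mult_distrib)
  ultimately show ?thesis by (rule right_inverse_unique)
qed

lemma series_eqs:
  "w * alpha Minus (w\<^sup>2) = zeta" "gamma Minus (w\<^sup>2) = gam"
  "w * map2 neg_square (beta Minus w) = bet"
  "alpha Plus (w\<^sup>2) = alp" "w * gamma Plus (w\<^sup>2) = del"
  "w * map2 neg_square (beta Plus w) = bet'"
  unfolding alpha_def gamma_def beta_def recip_den_w2
    neg_square2.mult[of _ "recip _"] neg_square2_recip
    zeta_def gam_def bet_def alp_def del_def bet'_def
  by (simp_all add: neg_square2.hom_simps neg_square2_vars)
    (simp_all add: eval_nat_numeral algebra_simps)

text \<open>These parities in \<open>w\<close> fix the signs in all brackets and decide which
  \<open>X\<close> terms vanish.\<close>

lemma flip2_series: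
  "flip2 zeta = - zeta" "flip2 gam = gam" "flip2 bet = - bet" "flip2 alp = alp" "flip2 del = - del"
  by (simp_all add: zeta_def gam_def bet_def alp_def del_def flip2.hom_simps flip2_vars flip2_rden
      algebra_simps)

text \<open>The first two equations are the odd and the even part of the comparison of
  \<open>x\<^sup>-\<close> terms in \<open>N'\<close>, the third compares the
  \<open>X\<^sup>-\<close> terms. The fourth and fifth give the equation for the positive part, the
  last one the conjugation by the Cartan factor.\<close>

lemma series_ode:
  "fps_deriv zeta = 4 * bet - 6 * zeta * gam"
  "fps_deriv gam = - 3 * zeta ^ 2 - gam ^ 2"
  "fps_deriv bet = fps_deriv zeta * gam - zeta ^ 3 + 3 * zeta * gam ^ 2 - 4 * bet * gam"
  "fps_deriv del + fps_deriv alp = scl"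
  "fps_deriv bet' = - (del * fps_deriv alp)"
  "fps_deriv scl = - (6 * zeta + 2 * gam) * scl"
proof -
  define W where "W = w * u * v"
  define s where "s = w * v"
  have W': "fps_deriv W = s" by (simp add: W_def s_def fps_deriv_vars)
  have s': "fps_deriv s = 0" by (simp add: s_def fps_deriv_vars)
  have us: "u * s = W" by (simp add: W_def s_def)
  have r': "fps_deriv rden = s * (12 * W - 4 * W ^ 3) * rden ^ 2"
    using fps_deriv_rden by (simp add: W_def s_def)
  have dr: "(1 - 6 * W ^ 2 + W ^ 4) * rden = 1" using den_rden by (simp add: W_def den_def)
  note defs = zeta_def gam_def bet_def alp_def del_def bet'_def scl_def
  note d = defs[folded W_def s_def]
  define Q where "Q = 1 - 6 * W ^ 2 + W ^ 4"
  \<comment> \<open>Inserting \<open>Q * rden = 1\<close> brings all terms to the same power of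
    \<open>rden\<close>; the claims then reduce to polynomial identities.\<close>
  have key: "A * rden = A * Q * rden ^ 2" for A
    using dr[folded Q_def] by (simp add: power2_eq_square mult.assoc)
  have key2: "A * rden ^ 2 = A * Q * rden ^ 3" for A
    unfolding power2_eq_square mult.assoc[symmetric] key[of "A * rden"] power3_eq_cube
    by (simp only: power2_eq_square mult_ac)
  have r2: "fps_deriv (rden ^ 2) = s * (24 * W - 8 * W ^ 3) * rden ^ 3"
    unfolding power2_eq_square[of rden] fps_deriv_mult r' by algebra
  have W2: "fps_deriv (W ^ 2) = 2 * W * s" "fps_deriv (W ^ 3) = 3 * W ^ 2 * s" "fps_deriv (W ^ 4) = 4 * W ^ 3 * s"
    by (simp_all add: fps_deriv_power' W')
  note D = fps_deriv_vars W' W2 s' r' r2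
  have 1: "fps_deriv zeta = 2 * s ^ 2 * W * rden + s ^ 2 * (1 + W ^ 2) * (12 * W - 4 * W ^ 3) * rden ^ 2"
    unfolding d fps_deriv_mult fps_deriv_add fps_deriv_1 D by algebra
  show 1: "fps_deriv zeta = 4 * bet - 6 * zeta * gam"
    unfolding 1 unfolding key unfolding d Q_def by algebra
  have 2: "fps_deriv gam = s ^ 2 * (3 * W ^ 2 - 3) * rden + s ^ 2 * (W ^ 3 - 3 * W) * (12 * W - 4 * W ^ 3) * rden ^ 2"
    unfolding d fps_deriv_mult fps_deriv_sub fps_deriv_numeral D by algebra
  show 2: "fps_deriv gam = - 3 * zeta ^ 2 - gam ^ 2"
    unfolding 2 unfolding key unfolding d Q_def by algebra
  have 3: "fps_deriv bet = - (s ^ 3 * (1 + 12 * W ^ 2 - 5 * W ^ 4)) * rden ^ 2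
      - s ^ 3 * W * (1 + 4 * W ^ 2 - W ^ 4) * (24 * W - 8 * W ^ 3) * rden ^ 3"
    unfolding d fps_deriv_neg power2_eq_square[of s] fps_deriv_mult fps_deriv_add fps_deriv_sub
      fps_deriv_1 fps_deriv_numeral D by algebra
  show "fps_deriv bet = fps_deriv zeta * gam - zeta ^ 3 + 3 * zeta * gam ^ 2 - 4 * bet * gam"
    unfolding 1 unfolding 3 unfolding key2 unfolding d Q_def by algebra
  have 4: "fps_deriv del = (W ^ 3 - 3 * W + (3 * W ^ 2 - 3) * (u * s)) * rden
      + (W ^ 3 - 3 * W) * (12 * W - 4 * W ^ 3) * (u * s) * rden ^ 2"
    unfolding d fps_deriv_mult fps_deriv_sub fps_deriv_numeral D by algebra
  have 5: "fps_deriv alp = (1 + W ^ 2 + 2 * W * (u * s)) * rden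
      + (1 + W ^ 2) * (12 * W - 4 * W ^ 3) * (u * s) * rden ^ 2"
    unfolding d fps_deriv_mult fps_deriv_add fps_deriv_1 D by algebra
  show "fps_deriv del + fps_deriv alp = scl"
    unfolding 4 5 us unfolding key unfolding d Q_def by algebra
  have 6: "fps_deriv bet' = (2 * u * W * (1 + 4 * W ^ 2 - W ^ 4)
        + u * (u * s) * (1 + 12 * W ^ 2 - 5 * W ^ 4)) * rden ^ 2
      + u * (u * s) * W * (1 + 4 * W ^ 2 - W ^ 4) * (24 * W - 8 * W ^ 3) * rden ^ 3"
    unfolding d power2_eq_square[of u] fps_deriv_mult fps_deriv_add fps_deriv_sub
      fps_deriv_1 fps_deriv_numeral D by algebra
  have 7: "del * fps_deriv alp = u * (W ^ 3 - 3 * W) * (1 + W ^ 2 + 2 * W * W) * rden ^ 2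
      + u * (W ^ 3 - 3 * W) * (1 + W ^ 2) * (12 * W - 4 * W ^ 3) * W * rden ^ 3"
    unfolding 5 us unfolding d by algebra
  show "fps_deriv bet' = - (del * fps_deriv alp)"
    unfolding 6 7 us unfolding key2 unfolding Q_def by algebra
  \<comment> \<open>The factorisation of \<open>Q\<close> gives the term of the derivative that
    carries only \<open>q ^ 2\<close> the missing third factor \<open>q\<close>.\<close>
  define q where "q = 1 - 2 * W - W ^ 2"
  have Q: "Q = (1 + 2 * W - W ^ 2) * q" unfolding Q_def q_def by algebra
  have q': "fps_deriv q = - 2 * s - 2 * W * s"
    unfolding q_def fps_deriv_mult fps_deriv_sub fps_deriv_1 fps_deriv_numeral D by algebra
  have scl: "scl = q ^ 3 * rden ^ 2" unfolding d q_def ..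
  have 8: "fps_deriv scl = q ^ 2 * (- 6 * s - 6 * W * s) * rden ^ 2 + q ^ 3 * s * (24 * W - 8 * W ^ 3) * rden ^ 3"
    unfolding scl power3_eq_cube[of q] fps_deriv_mult D q' by (simp add: algebra_simps power2_eq_square)
  show "fps_deriv scl = - (6 * zeta + 2 * gam) * scl"
    unfolding 8 unfolding key2 unfolding scl zeta_def[folded W_def s_def] gam_def[folded W_def s_def] Q
    by (simp add: algebra_simps eval_nat_numeral)
qed


section \<open>The factorisation\<close>

lemma W_nth_0: "fps_nth u 0 = 0" "fps_nth (w * u * v) 0 = 0"
  by (simp_all add: u_def fps_mult_nth_0)

text \<open>Among these exponents only \<open>zeta\<close> survives at \<open>u = 0\<close>, with
  the value \<open>w * v\<close> that matches the factor
  \<open>exp(x\<^sub>1\<^sup>- v)\<close>.\<close>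

lemma series_nth_0:
  "coeff2 zeta 0 0 = 0" "fps_nth gam 0 = 0" "fps_nth bet 0 = 0"
  "fps_nth alp 0 = 0" "fps_nth del 0 = 0" "fps_nth bet' 0 = 0" "fps_nth scl 0 = 1"
  "fps_nth zeta 0 = fps_nth (w * v) 0"
  by (simp_all add: zeta_def gam_def bet_def alp_def del_def bet'_def scl_def W_nth_0 fps_mult_nth_0
      power_nth_0 rden_nth_0) (simp add: v_def)

lemma eta_nth_0: "fps_nth (eta w) 0 = 0"
proof -
  have "fps_nth (ln1p z) 0 = 0" if "fps_nth z 0 = 0" for z
  proof -
    \<comment> \<open>For \<open>n = 0\<close> the coefficient of the logarithm is 0, otherwise the
      power of 0 is.\<close>
    have "[:fps_nth (fps_ln (1 :: rat)) n:] * fps_nth (0 ^ n :: rat poly fps) j = 0" for n j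
      by (cases n) simp_all
    then show ?thesis
      by (simp only: ln1p_def subst2_def power_nth_0 fps_eq_iff fps_nth_Abs_fps that fps_zero_nth sum.neutral_const) simp
  qed
  moreover have "fps_nth (2 * w * u * v - w\<^sup>2 * u\<^sup>2 * v\<^sup>2) 0 = 0"
    by (simp add: fps_mult_nth_0 W_nth_0 power_nth_0)
  ultimately show ?thesis by (simp add: eta_def fps_mult_nth_0)
qed

text \<open>With \<open>W = w u v\<close> and \<open>p = 1 + 2 W - W\<^sup>2\<close>, the derivative
  is \<open>w v (1 - W) / p\<close>. The numerator of \<open>zeta + gam\<close> is
  \<open>w v (1 - W)\<close> times the other factor of \<open>den\<close>.\<close>

lemma fps_deriv_eta: "fps_deriv (eta w) = zeta + gam"
proof -
  define W where "W = w * u * v"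
  define s where "s = w * v"
  define z where "z = 2 * w * u * v - w\<^sup>2 * u\<^sup>2 * v\<^sup>2"
  have W': "fps_deriv W = s" by (simp add: W_def s_def fps_deriv_vars)
  have z: "z = 2 * W - W ^ 2" by (simp add: z_def W_def power_mult_distrib mult.assoc)
  have "coeff2 z 0 0 = 0" by (simp add: z W_def W_nth_0 power_nth_0)
  then have "fps_deriv (ln1p z) * (1 + z) = 2 * (s * (1 - W))"
    by (subst fps_deriv_ln1p) (simp_all add: z W' fps_deriv_power' algebra_simps)
  moreover have "const2 [:1/2:] * 2 = (1 :: rat poly fps fps)"
    by (simp add: mult_2_right pCons_one)
  moreover have "fps_deriv (eta w) = const2 [:1/2:] * fps_deriv (ln1p z)"
    by (simp add: eta_def z_def)
  ultimately have *: "fps_deriv (eta w) * (1 + z) = s * (1 - W)"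
    by (simp only: mult.assoc) (simp only: mult.assoc[symmetric] mult_1)
  have "fps_deriv (eta w) = fps_deriv (eta w) * (den * rden)"
    by (simp add: den_rden)
  also have "den = (1 + z) * (1 - 2 * W - W ^ 2)"
    by (simp add: den_def z flip: W_def) (simp add: algebra_simps eval_nat_numeral)
  finally have "fps_deriv (eta w) = fps_deriv (eta w) * (1 + z) * ((1 - 2 * W - W ^ 2) * rden)"
    by (simp only: mult.assoc)
  then show ?thesis unfolding *
    by (simp add: zeta_def gam_def flip: W_def s_def) (simp add: algebra_simps eval_nat_numeral)
qed

lemma fps_deriv_hh: "fps_deriv (hh \<xi>) = hh (fps_deriv \<xi>)"
  and fps_deriv_xx: "fps_deriv (xx \<sigma> \<xi>) = xx \<sigma> (fps_deriv \<xi>)"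
  and fps_deriv_XX: "fps_deriv (XX \<sigma> \<xi>) = XX \<sigma> (fps_deriv \<xi>)"
  by (intro fps_deriv_map_coeffs additive_map_coeffs additive_lin)+

lemma fps_deriv_flip2: "flip2 (fps_deriv \<xi>) = fps_deriv (flip2 \<xi>)"
  by (intro fps_deriv_map_coeffs[symmetric] additive_map_coeffs sgn_flip.additive_axioms)

lemma map2_lin_nth_0:
  "fps_nth \<xi> 0 = 0 \<Longrightarrow> fps_nth (map2 (lin g) \<xi>) 0 = 0"
  "coeff2 \<xi> 0 0 = 0 \<Longrightarrow> coeff2 (map2 (lin g) \<xi>) 0 0 = 0"
  by (simp_all add: additive.zero additive_lin additive_map_coeffs)

lemma xx_const: "xx \<sigma> 1 = const2 (env_gen (Gx \<sigma> 0))" "xx \<sigma> w = const2 (env_gen (Gx \<sigma> 1))"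
proof -
  have 1: "lin (gx \<sigma>) 1 = env_gen (Gx \<sigma> 0)"
    using lin_monom[of "gx \<sigma>" 1 0] by (simp add: gx_def env_const_simps(4))
  have 2: "lin (gx \<sigma>) [:0, 1:] = env_gen (Gx \<sigma> 1)"
    using lin_monom[of "gx \<sigma>" 1 1] by (simp add: gx_def env_const_simps(4) monom_altdef)
  have 0: "lin (gx \<sigma>) 0 = 0" by (rule additive.zero[OF additive_lin])
  show "xx \<sigma> 1 = const2 (env_gen (Gx \<sigma> 0))" "xx \<sigma> w = const2 (env_gen (Gx \<sigma> 1))"
    by (auto simp: fps_eq_iff w_def 0 1 2)
qed

text \<open>The exponent commutes with its derivative: for a label of definite parity their bracket
  is, up to sign, \<open>XX\<close> of the even series
  \<open>fps_deriv \<xi> * \<xi>\<close>.\<close>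

lemma fps_deriv_exp_xx:
  assumes "coeff2 \<xi> 0 0 = 0" "flip2 \<xi> = \<xi> \<or> flip2 \<xi> = - \<xi>"
  shows "fps_deriv (exp_env (xx \<sigma> \<xi>)) = exp_env (xx \<sigma> \<xi>) * xx \<sigma> (fps_deriv \<xi>)"
proof -
  have "flip2 (fps_deriv \<xi> * \<xi>) = fps_deriv \<xi> * \<xi>"
    using assms(2) by (auto simp: flip2.mult fps_deriv_flip2)
  then have "XX \<sigma> (fps_deriv \<xi> * \<xi>) = 0" by (rule XX_even_eq_0)
  then have "comm (xx \<sigma> (fps_deriv \<xi>)) (xx \<sigma> \<xi>) = 0"
    using assms(2) by (cases \<sigma>) (auto simp: comm_series XX.minus simp del: right_minus_eq)
  then show ?thesis
    by (simp only: fps_deriv_exp_env[OF map2_lin_nth_0(2)[OF assms(1)]] fps_deriv_xx)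
qed

lemma fps_deriv_exp_XX:
  "coeff2 \<xi> 0 0 = 0 \<Longrightarrow> fps_deriv (exp_env (XX \<sigma> \<xi>)) = exp_env (XX \<sigma> \<xi>) * XX \<sigma> (fps_deriv \<xi>)"
  by (simp only: fps_deriv_exp_env[OF map2_lin_nth_0(2)] fps_deriv_XX commute_series)

lemma fps_deriv_exp_hh:
  "coeff2 \<xi> 0 0 = 0 \<Longrightarrow> fps_deriv (exp_env (hh \<xi>)) = exp_env (hh \<xi>) * hh (fps_deriv \<xi>)"
  by (simp only: fps_deriv_exp_env[OF map2_lin_nth_0(2)] fps_deriv_hh commute_series)

lemma map2_mult_v: "map2 f (x * v) = map2 f x * v" if "additive f"
  by (simp add: fps_eq_iff v_def additive.zero[OF that])

lemma numeral_xx: "numeral k * xx \<sigma> x = xx \<sigma> (numeral k * x)"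
  and numeral_XX: "numeral k * XX \<sigma> x = XX \<sigma> (numeral k * x)"
  by (rule additive_numeral_mult[symmetric], rule xx.additive_axioms XX.additive_axioms)+

text \<open>Makes an exchange rule applicable inside a product nested to the right.\<close>

lemma mult_exchange: "a * e = e * b \<Longrightarrow> a * (e * y) = e * (b * (y :: 'a::semigroup_mult))"
  by (metis mult.assoc)

theorem proposition6p34:
  shows "exp_env (const2 (env_gen (Gx Plus 0)) * u) * exp_env (const2 (env_gen (Gx Minus 1)) * v) =
      exp_env (alpha Minus (w^2) \<star> L_gen (Lx Minus 1))
    * exp_env (beta Minus w \<star> L_gen (LX Minus 0))
    * exp_env (gamma Minus (w^2) \<star> L_gen (Lx Minus 0))
    * exp_env (eta w \<star> L_gen (Lh 0))
    * exp_env (gamma Plus (w^2) \<star> L_gen (Lx Plus 1))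
    * exp_env (beta Plus w \<star> L_gen (LX Plus 0))
    * exp_env (alpha Plus (w^2) \<star> L_gen (Lx Plus 0))"
  unfolding act_Lx_1 act_Lx act_LX act_Lh series_eqs
proof (rule ode_unique_left)
  let ?x = "xx Plus 1"
  let ?y = "const2 (env_gen (Gx Minus 1)) * v :: env fps fps"
  define E1 where "E1 = exp_env (xx Minus zeta)"
  define E2 where "E2 = exp_env (XX Minus bet)"
  define E3 where "E3 = exp_env (xx Minus gam)"
  define H where "H = exp_env (hh (eta w))"
  define P1 where "P1 = exp_env (xx Plus del)"
  define P2 where "P2 = exp_env (XX Plus bet')"
  define P3 where "P3 = exp_env (xx Plus alp)"
  note nth_0 = series_nth_0 eta_nth_0
  note c0 = nth_0(1) nth_0(2-6)[THEN arg_cong, of "\<lambda>x. fps_nth x 0", simplified]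
    eta_nth_0[THEN arg_cong, of "\<lambda>x. fps_nth x 0", simplified]

  have x': "fps_deriv ?x = 0" by (simp add: xx_const)

  \<comment> \<open>Even labels have no \<open>X\<close> component: \<open>gam ^ 3\<close> ends the
    chain of brackets for \<open>E3\<close>, and \<open>zeta ^ 2 * gam\<close> disappears from
    \<open>N'\<close>.\<close>
  have even: "flip2 (zeta ^ 2 * gam) = zeta ^ 2 * gam" "flip2 (gam ^ 3) = gam ^ 3"
    by (simp_all add: flip2.hom_simps flip2_series)
  note XX_0 = even[THEN XX_even_eq_0]
  note brackets = comm_series flip2_series flip2.hom_simps numeral_xx numeral_XX

  \<comment> \<open>Moving \<open>x\<^sub>0\<^sup>+\<close> through the negative factors\<close>
  have x_E1: "?x * E1 = E1 * (?x + hh zeta + xx Minus (- 3 * zeta ^ 2) + XX Minus (- (zeta ^ 3)))"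
    unfolding E1_def
  proof (rule exp_env_commute3)
    show "comm ?x (xx Minus zeta) = hh zeta" unfolding brackets by simp
    \<comment> \<open>As \<open>zeta\<close> is odd, \<open>2 * flip2 zeta - 4 * zeta\<close> equals
      \<open>- 6 * zeta\<close>.\<close>
    show "comm (hh zeta) (xx Minus zeta) = 2 * xx Minus (- 3 * zeta ^ 2)"
      unfolding brackets by (rule arg_cong[where f = "xx Minus"]) (simp add: power2_eq_square)
    show "comm (xx Minus (- 3 * zeta ^ 2)) (xx Minus zeta) = 3 * XX Minus (- (zeta ^ 3))"
      unfolding brackets by (rule arg_cong[where f = "XX Minus"]) (simp add: power2_eq_square power3_eq_cube)
  qed (rule map2_lin_nth_0 c0 commute_series)+

  have E2_0: "coeff2 (XX Minus bet) 0 0 = 0" by (intro map2_lin_nth_0 c0)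
  have x_E2: "?x * E2 = E2 * (?x + xx Minus (4 * bet))"
  proof -
    have "?x * E2 = E2 * (?x + xx Minus (4 * bet) + 0 + 0)"
      unfolding E2_def
    proof (rule exp_env_commute3[OF E2_0])
      show "comm ?x (XX Minus bet) = xx Minus (4 * bet)"
        unfolding brackets by (rule arg_cong[where f = "xx Minus"]) simp
      show "comm (xx Minus (4 * bet)) (XX Minus bet) = 2 * 0" unfolding commute_series by simp
    qed simp_all
    then show ?thesis by simp
  qed
  \<comment> \<open>The bracket carries the factor \<open>zeta + flip2 zeta\<close>, which is 0 by
    oddness.\<close>
  have "comm (hh zeta) (XX Minus bet) = 0"
    unfolding brackets by (simp add: XX.zero)
  then have h_E2: "hh zeta * E2 = E2 * hh zeta"
    unfolding E2_def by (rule exp_env_commute0[OF E2_0])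
  have xm_E2: "xx Minus y * E2 = E2 * xx Minus y" and Xm_E2: "XX Minus y * E2 = E2 * XX Minus y" for y
    unfolding E2_def by (rule exp_env_commute0[OF E2_0], rule commute_series)+

  have E3_0: "coeff2 (xx Minus gam) 0 0 = 0" by (intro map2_lin_nth_0 c0)
  have x_E3: "?x * E3 = E3 * (?x + hh gam + xx Minus (- (gam ^ 2)))"
  proof -
    have "?x * E3 = E3 * (?x + hh gam + xx Minus (- (gam ^ 2)) + 0)"
      unfolding E3_def
    proof (rule exp_env_commute3[OF E3_0])
      show "comm ?x (xx Minus gam) = hh gam" unfolding brackets by simp
      \<comment> \<open>As \<open>gam\<close> is even, the factor is now \<open>- 2\<close> instead
        of \<open>- 6\<close>.\<close>
      show "comm (hh gam) (xx Minus gam) = 2 * xx Minus (- (gam ^ 2))"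
        unfolding brackets by (rule arg_cong[where f = "xx Minus"]) (simp add: power2_eq_square)
      have "comm (xx Minus (- (gam ^ 2))) (xx Minus gam) = XX Minus (gam ^ 3)"
        unfolding brackets
        by (rule arg_cong[where f = "XX Minus"]) (simp add: power2_eq_square power3_eq_cube)
      then show "comm (xx Minus (- (gam ^ 2))) (xx Minus gam) = 3 * 0" by (simp only: XX_0 mult_zero_right)
    qed simp
    then show ?thesis by simp
  qed
  have h_E3: "hh zeta * E3 = E3 * (hh zeta + xx Minus (- 6 * zeta * gam) + XX Minus (3 * zeta * gam ^ 2))"
  proof -
    have "hh zeta * E3 = E3 * (hh zeta + xx Minus (- 6 * zeta * gam) + XX Minus (3 * zeta * gam ^ 2) + 0)"
      unfolding E3_def
    proof (rule exp_env_commute3[OF E3_0])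
      show "comm (hh zeta) (xx Minus gam) = xx Minus (- 6 * zeta * gam)"
        unfolding brackets by (rule arg_cong[where f = "xx Minus"]) simp
      show "comm (xx Minus (- 6 * zeta * gam)) (xx Minus gam) = 2 * XX Minus (3 * zeta * gam ^ 2)"
        unfolding brackets by (rule arg_cong[where f = "XX Minus"]) (simp add: power2_eq_square)
      show "comm (XX Minus (3 * zeta * gam ^ 2)) (xx Minus gam) = 3 * 0"
        unfolding commute_series by simp
    qed simp
    then show ?thesis by simp
  qed
  have xm_E3: "xx Minus y * E3 = E3 * (xx Minus y + XX Minus (- (y * gam)))" for y
  proof -
    have "xx Minus y * E3 = E3 * (xx Minus y + XX Minus (- (y * gam)) + 0 + 0)"
      unfolding E3_def
    proof (rule exp_env_commute3[OF E3_0])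
      show "comm (xx Minus y) (xx Minus gam) = XX Minus (- (y * gam))"
        unfolding brackets by simp
      show "comm (XX Minus (- (y * gam))) (xx Minus gam) = 2 * 0"
        unfolding commute_series by simp
    qed simp_all
    then show ?thesis by simp
  qed
  have Xm_E3: "XX Minus y * E3 = E3 * XX Minus y" for y
    unfolding E3_def by (rule exp_env_commute0[OF E3_0], rule commute_series)

  have N': "?x * (E1 * E2 * E3) = fps_deriv (E1 * E2 * E3) + E1 * E2 * E3 * (?x + hh (fps_deriv (eta w)))"
  proof -
    have E': "fps_deriv E1 = E1 * xx Minus (fps_deriv zeta)" "fps_deriv E2 = E2 * XX Minus (fps_deriv bet)"
      "fps_deriv E3 = E3 * xx Minus (fps_deriv gam)"
      unfolding E1_def E2_def E3_def
      by (rule fps_deriv_exp_xx fps_deriv_exp_XX c0 | simp add: flip2_series)+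
    have "XX Minus (3 * (zeta ^ 2 * gam)) = 0" unfolding numeral_XX[symmetric] XX_0 by simp
    then have even: "XX Minus (gam * (zeta * (zeta * 3))) = 0" by (simp add: power2_eq_square mult_ac)
    have six: "XX Minus (gam * (gam * (zeta * 6))) =
        XX Minus (gam * (gam * (zeta * 3))) + XX Minus (gam * (gam * (zeta * 3)))"
      unfolding XX.add[symmetric] by (rule arg_cong[where f = "XX Minus"]) simp
    note exchange = x_E1 x_E2 x_E3 h_E2 h_E3 xm_E2 xm_E3 Xm_E2 Xm_E3
    \<comment> \<open>The summands are grouped by origin: what passing \<open>E3\<close> makes of
      \<open>x\<^sub>0\<^sup>+\<close>, then of the \<open>x\<^sup>-\<close> created at
      \<open>E2\<close>, then of the \<open>h\<close>, \<open>x\<^sup>-\<close> and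
      \<open>X\<^sup>-\<close> created at \<open>E1\<close>.\<close>
    have "?x * (E1 * (E2 * E3)) = E1 * (E2 * (E3 * (?x + hh gam + xx Minus (- (gam ^ 2))
        + (xx Minus (4 * bet) + XX Minus (- (4 * bet * gam)))
        + (hh zeta + xx Minus (- 6 * zeta * gam) + XX Minus (3 * zeta * gam ^ 2))
        + (xx Minus (- 3 * zeta ^ 2) + XX Minus (- (- 3 * zeta ^ 2 * gam))) + XX Minus (- (zeta ^ 3)))))"
      by (simp only: exchange exchange[THEN mult_exchange] distrib_left distrib_right add.assoc)
    \<comment> \<open>The target is the derivative with its inner factors moved to the right; the
      term with \<open>fps_deriv zeta * gam\<close> arises when
      \<open>xx Minus (fps_deriv zeta)\<close> passes \<open>E3\<close>.\<close>
    also have "\<dots> = E1 * (E2 * (E3 * (xx Minus (fps_deriv zeta) + XX Minus (- (fps_deriv zeta * gam))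
         + XX Minus (fps_deriv bet) + xx Minus (fps_deriv gam) + (?x + hh (fps_deriv (eta w))))))"
      unfolding series_ode(2,3) fps_deriv_eta unfolding series_ode(1)
      by (intro arg_cong[where f = "\<lambda>x. E1 * (E2 * (E3 * x))"])
        (simp add: xx.add xx.diff xx.minus XX.add XX.diff XX.minus hh.add even six algebra_simps
          power2_eq_square power3_eq_cube)
    also have "\<dots> = fps_deriv (E1 * (E2 * E3)) + E1 * (E2 * (E3 * (?x + hh (fps_deriv (eta w)))))"
      by (simp only: fps_deriv_mult E' exchange exchange[THEN mult_exchange] distrib_left distrib_right mult.assoc)
        (simp only: ac_simps)
    finally show ?thesis by (simp only: mult.assoc)
  qed

  \<comment> \<open>Conjugation by the Cartan factor\<close>
  have x_H: "?x * H = H * xx Plus scl"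
  proof (rule ode_unique_right)
    have H': "fps_deriv H = H * hh (fps_deriv (eta w))"
      unfolding H_def by (intro fps_deriv_exp_hh c0)
    show "fps_deriv (?x * H) = ?x * H * hh (fps_deriv (eta w))"
      by (simp add: x' H' mult.assoc)
    \<comment> \<open>The operator \<open>4 - 2 * flip2\<close> sends the odd \<open>zeta\<close> to
      \<open>6 * zeta\<close> and the even \<open>gam\<close> to \<open>2 * gam\<close>, which is
      the factor in the equation for \<open>scl\<close>.\<close>
    have "comm (hh (fps_deriv (eta w))) (xx Plus scl) = - xx Plus (fps_deriv scl)"
      unfolding fps_deriv_eta series_ode comm_series xx.minus[symmetric] flip2.hom_simps flip2_series
      by (rule arg_cong[where f = "xx Plus"]) (simp add: algebra_simps)
    then have "hh (fps_deriv (eta w)) * xx Plus scl + xx Plus (fps_deriv scl) = xx Plus scl * hh (fps_deriv (eta w))"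
      by (simp add: algebra_simps)
    then show "fps_deriv (H * xx Plus scl) = H * xx Plus scl * hh (fps_deriv (eta w))"
      by (simp only: fps_deriv_mult H' fps_deriv_xx mult.assoc) (simp only: distrib_left[symmetric] add.commute)
    have "fps_nth (xx Plus scl) 0 = fps_nth ?x 0"
      by (simp add: nth_0)
    moreover have "fps_nth H 0 = 1"
      unfolding H_def by (intro exp_env_nth_0 map2_lin_nth_0 nth_0)
    ultimately show "fps_nth (?x * H) 0 = fps_nth (H * xx Plus scl) 0"
      by (simp only: fps_mult_nth_0 mult_1 mult_1_right)
  qed

  \<comment> \<open>The differential equation of the positive part\<close>
  have P': "fps_deriv (P1 * P2 * P3) = xx Plus scl * (P1 * P2 * P3)"
  proof -
    have c: "coeff2 (xx Plus del) 0 0 = 0" "coeff2 (XX Plus bet') 0 0 = 0" "coeff2 (xx Plus alp) 0 0 = 0"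
      by (intro map2_lin_nth_0 c0)+
    have x_P1: "xx Plus y * P1 = P1 * (xx Plus y + XX Plus (- (y * del)))" for y
    proof -
      have "xx Plus y * P1 = P1 * (xx Plus y + XX Plus (- (y * del)) + 0 + 0)"
        unfolding P1_def
      proof (rule exp_env_commute3[OF c(1)])
        show "comm (xx Plus y) (xx Plus del) = XX Plus (- (y * del))"
          unfolding brackets by simp
        show "comm (XX Plus (- (y * del))) (xx Plus del) = 2 * 0"
          unfolding commute_series by simp
      qed simp_all
      then show ?thesis by simp
    qed
    have x_P3: "xx Plus y * P3 = P3 * (xx Plus y + XX Plus (y * alp))" for y
    proof -
      have "xx Plus y * P3 = P3 * (xx Plus y + XX Plus (y * alp) + 0 + 0)"
        unfolding P3_def
      proof (rule exp_env_commute3[OF c(3)])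
        show "comm (xx Plus y) (xx Plus alp) = XX Plus (y * alp)"
          unfolding brackets by simp
        show "comm (XX Plus (y * alp)) (xx Plus alp) = 2 * 0"
          unfolding commute_series by simp
      qed simp_all
      then show ?thesis by simp
    qed
    have x_P2: "xx Plus y * P2 = P2 * xx Plus y" and X_P2: "XX Plus y * P2 = P2 * XX Plus y"
      and X_P3: "XX Plus y * P3 = P3 * XX Plus y" for y
      unfolding P2_def P3_def by (rule exp_env_commute0[OF c(2)], rule commute_series)+
        (rule exp_env_commute0[OF c(3)], rule commute_series)
    have D: "fps_deriv P1 = P1 * xx Plus (fps_deriv del)" "fps_deriv P2 = P2 * XX Plus (fps_deriv bet')"
      "fps_deriv P3 = P3 * xx Plus (fps_deriv alp)"
      unfolding P1_def P2_def P3_def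
      by (rule fps_deriv_exp_xx fps_deriv_exp_XX c0 | simp add: flip2_series)+
    \<comment> \<open>With \<open>scl = fps_deriv del + fps_deriv alp\<close>, evenness leaves
      \<open>fps_deriv del * alp\<close> from \<open>scl * alp\<close>, and
      \<open>fps_deriv alp * del\<close> from \<open>scl * del\<close>; the latter, negated, is the
      derivative of \<open>bet'\<close>.\<close>
    have "flip2 (fps_deriv del * del) = fps_deriv del * del" "flip2 (fps_deriv alp * alp) = fps_deriv alp * alp"
      by (simp_all add: flip2.hom_simps flip2_series fps_deriv_flip2)
    note even = this[THEN XX_even_eq_0]
    note exchange = x_P1 x_P2 x_P3 X_P2 X_P3
    have "xx Plus scl * (P1 * (P2 * P3)) =
        P1 * (P2 * (P3 * (xx Plus scl + XX Plus (scl * alp) + XX Plus (- (scl * del)))))"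
      by (simp only: exchange exchange[THEN mult_exchange] distrib_left distrib_right add.assoc)
    also have "\<dots> = P1 * (P2 * (P3 * (xx Plus (fps_deriv del) + XX Plus (fps_deriv del * alp)
        + XX Plus (fps_deriv bet') + xx Plus (fps_deriv alp))))"
      unfolding series_ode(4)[symmetric] series_ode(5)
      by (intro arg_cong[where f = "\<lambda>x. P1 * (P2 * (P3 * x))"])
        (simp add: xx.add XX.add XX.diff XX.minus even distrib_right mult.commute[of del])
    also have "\<dots> = fps_deriv (P1 * (P2 * P3))"
      by (simp only: fps_deriv_mult D exchange exchange[THEN mult_exchange] distrib_left distrib_right mult.assoc)
        (simp only: ac_simps)
    finally show ?thesis by (simp only: mult.assoc)
  qed

  \<comment> \<open>Assembling the negative, Cartan and positive parts\<close>
  have h_H: "H * hh \<xi> = hh \<xi> * H" for \<xi>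
    unfolding H_def by (rule exp_env_commute0[symmetric]) (rule map2_lin_nth_0 c0 commute_series)+
  show "fps_deriv (E1 * E2 * E3 * H * P1 * P2 * P3) = ?x * (E1 * E2 * E3 * H * P1 * P2 * P3)"
  proof -
    define N where "N = E1 * E2 * E3"
    define P where "P = P1 * P2 * P3"
    have H': "fps_deriv H = hh (fps_deriv (eta w)) * H"
      unfolding h_H[symmetric] unfolding H_def by (intro fps_deriv_exp_hh c0)
    have "?x * (N * (H * P)) = (?x * N) * (H * P)" by (simp only: mult.assoc)
    \<comment> \<open>These three terms are turned into the three terms of the product rule for
      \<open>N * (H * P)\<close>.\<close>
    also have "\<dots> = fps_deriv N * (H * P) + N * (?x * H * P) + N * (hh (fps_deriv (eta w)) * H * P)"
      unfolding N'[folded N_def] by (simp only: distrib_left distrib_right mult.assoc add.assoc)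
    also have "N * (?x * H * P) = N * (H * fps_deriv P)"
      unfolding x_H P'[folded P_def] by (simp only: mult.assoc)
    also have "fps_deriv N * (H * P) + \<dots> + N * (hh (fps_deriv (eta w)) * H * P) = fps_deriv (N * (H * P))"
      unfolding H'[symmetric] by (simp add: algebra_simps)
    finally show ?thesis by (simp only: N_def P_def mult.assoc)
  qed

  \<comment> \<open>The left-hand side and the values at \<open>u = 0\<close>\<close>
  let ?z = "const2 (env_gen (Gx Plus 0)) * u :: env fps fps"
  show "fps_deriv (exp_env ?z * exp_env ?y) = ?x * (exp_env ?z * exp_env ?y)"
  proof -
    have c: "coeff2 ?z 0 0 = 0" "coeff2 ?y 0 0 = 0"
      by (simp_all add: u_def v_def fps_mult_nth_0)
    have z': "fps_deriv ?z = ?x" by (simp add: xx_const u_def)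
    have com: "comm ?x ?z = 0"
      by (simp add: xx_const u_def mult.assoc fps_mult_fps_X_commute)
    \<comment> \<open>There is no \<open>u\<close> in \<open>?y\<close>, so its exponential is a
      constant for this derivation.\<close>
    have "fps_deriv ?y = 0" by (simp add: v_def)
    then have "fps_deriv (exp_env ?y) = 0"
      using fps_deriv_exp_env[OF c(2)] by simp
    moreover have "fps_deriv (exp_env ?z) = exp_env ?z * ?x"
      using fps_deriv_exp_env[OF c(1)] com by (simp only: z')
    moreover have "?x * exp_env ?z = exp_env ?z * ?x"
      by (rule exp_env_commute0[OF c(1) com])
    ultimately show ?thesis
      by (simp only: fps_deriv_mult mult_zero_right add_0 mult.assoc[symmetric])
  qed

  show "fps_nth (exp_env ?z * exp_env ?y) 0 = fps_nth (E1 * E2 * E3 * H * P1 * P2 * P3) 0"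
  proof -
    \<comment> \<open>At \<open>u = 0\<close> every other factor becomes 1, and both sides reduce to
      \<open>exp(x\<^sub>1\<^sup>- v)\<close>.\<close>
    have "xx Minus (w * v) = ?y" by (simp add: map2_mult_v additive_lin xx_const)
    then have "fps_nth (xx Minus zeta) 0 = fps_nth ?y 0"
      by (metis map_coeffs_nth nth_0(8))
    then have "fps_nth E1 0 = fps_nth (exp_env ?y) 0"
      unfolding E1_def by (rule exp_env_nth_0_cong)
    moreover have "fps_nth (exp_env ?z) 0 = 1"
      by (intro exp_env_nth_0) (simp add: u_def fps_mult_nth_0)
    moreover have "fps_nth E2 0 = 1" "fps_nth E3 0 = 1" "fps_nth H 0 = 1" "fps_nth P1 0 = 1"
      "fps_nth P2 0 = 1" "fps_nth P3 0 = 1"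
      unfolding E2_def E3_def H_def P1_def P2_def P3_def
      by (intro exp_env_nth_0 map2_lin_nth_0 nth_0)+
    ultimately show ?thesis by (simp add: fps_mult_nth_0)
  qed
qed

end
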